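(* Let $G$ be a hyperabelian group in which every subnormal abelian subgroup is normal, and let $B$ be the Baer radical of $G$. Suppose that $B$ is periodic. If $G$ is locally nilpotent, then $G$ satisfies the following conditions: (i) if $p$ is an odd prime, then the Sylow $p$-subgroup of $G$ is abelian; (ii) if the Sylow $2$-subgroup $D$ of $G$ is not nilpotent, then $D$ satisfies the following conditions: (iia) the Sylow $2$-subgroup $B_2$ of $B$ is abelian and the orders of the elements of $B_2$ are not bounded; (iib) $D = B_2\langle a\rangle$ for some element $a$ with $a^2 \in B_2$ and $x^a = x^{-1}$ for every element $x \in B_2$; (iic) $C_{B_2}(a)$ is an elementary abelian $2$-subgroup; (iid) either $a^2 = 1$ or $a^4 = 1$.
   Context: A group $G$ is hyperabelian if it has an ascending series of normal subgroups, from $\langle 1\rangle$ to $G$, whose factors are abelian. The Baer radical of $G$ is the subgroup generated by all subnormal cyclic subgroups of $G$. A Sylow $p$-subgroup is a maximal $p$-subgroup. $x^a = a^{-1}xa$. *)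

theory Defs
  imports "HOL-Algebra.Algebra"
begin

abbreviation subgroup_as_group :: "('a, 'b) monoid_scheme \<Rightarrow> 'a set \<Rightarrow> ('a, 'b) monoid_scheme"
  where "subgroup_as_group G H \<equiv> G\<lparr>carrier := H\<rparr>"

text \<open>
  An ascending series of normal subgroups of G from 1 to G is an ordinal-indexed family with
  unions at the limit stages.  It is represented here, without repetitions, by the set of its
  terms: a set of normal subgroups that is well-ordered by inclusion and closed under unions of
  nonempty subsets.  The factors are the quotients K/H of consecutive terms.
\<close>
definition ascending_normal_series :: "('a, 'b) monoid_scheme \<Rightarrow> 'a set set \<Rightarrow> bool" where
  "ascending_normal_series G S \<longleftrightarrow>
     (\<forall>H\<in>S. H \<lhd> G) \<and>
     {\<one>\<^bsub>G\<^esub>} \<in> S \<and> carrier G \<in> S \<and>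
     (\<forall>T. T \<subseteq> S \<and> T \<noteq> {} \<longrightarrow> (\<exists>H\<in>T. \<forall>K\<in>T. H \<subseteq> K)) \<and>
     (\<forall>T. T \<subseteq> S \<and> T \<noteq> {} \<longrightarrow> \<Union>T \<in> S)"

definition consecutive_terms :: "'a set set \<Rightarrow> 'a set \<Rightarrow> 'a set \<Rightarrow> bool" where
  "consecutive_terms S H K \<longleftrightarrow>
     H \<in> S \<and> K \<in> S \<and> H \<subset> K \<and> \<not> (\<exists>L\<in>S. H \<subset> L \<and> L \<subset> K)"

definition hyperabelian :: "('a, 'b) monoid_scheme \<Rightarrow> bool" where
  "hyperabelian G \<longleftrightarrow>
     (\<exists>S. ascending_normal_series G S \<and>
          (\<forall>H K. consecutive_terms S H K \<longrightarrow> comm_group (subgroup_as_group G K Mod H)))"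

definition subnormal_subgroup :: "'a set \<Rightarrow> ('a, 'b) monoid_scheme \<Rightarrow> bool" where
  "subnormal_subgroup H G \<longleftrightarrow>
     (\<exists>(n::nat) K. K 0 = H \<and> K n = carrier G \<and>
        (\<forall>i\<le>n. subgroup (K i) G) \<and>
        (\<forall>i<n. K i \<lhd> subgroup_as_group G (K (Suc i))))"

definition baer_radical :: "('a, 'b) monoid_scheme \<Rightarrow> 'a set" where
  "baer_radical G =
     generate G (\<Union>{H. subnormal_subgroup H G \<and> cyclic_group (subgroup_as_group G H)})"

definition periodic_group :: "('a, 'b) monoid_scheme \<Rightarrow> bool" where
  "periodic_group G \<longleftrightarrow> (\<forall>x\<in>carrier G. \<exists>n::nat. n > 0 \<and> x [^]\<^bsub>G\<^esub> n = \<one>\<^bsub>G\<^esub>)"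

definition group_center :: "('a, 'b) monoid_scheme \<Rightarrow> 'a set" where
  "group_center G = {z \<in> carrier G. \<forall>g\<in>carrier G. z \<otimes>\<^bsub>G\<^esub> g = g \<otimes>\<^bsub>G\<^esub> z}"

text \<open>Nilpotency is the existence of a finite central series K 0 = 1, ..., K n = G; the image of
  K (Suc i) in G/K i has to be contained in the centre of G/K i.\<close>
definition nilpotent_group :: "('a, 'b) monoid_scheme \<Rightarrow> bool" where
  "nilpotent_group G \<longleftrightarrow>
     (\<exists>(n::nat) K. K 0 = {\<one>\<^bsub>G\<^esub>} \<and> K n = carrier G \<and>
        (\<forall>i\<le>n. K i \<lhd> G) \<and>
        (\<forall>i<n. K i \<subseteq> K (Suc i) \<and>
               (\<lambda>x. K i #>\<^bsub>G\<^esub> x) ` K (Suc i) \<subseteq> group_center (G Mod K i)))"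

definition locally_nilpotent_group :: "('a, 'b) monoid_scheme \<Rightarrow> bool" where
  "locally_nilpotent_group G \<longleftrightarrow>
     (\<forall>F. finite F \<and> F \<subseteq> carrier G \<longrightarrow> nilpotent_group (subgroup_generated G F))"

definition p_subgroup :: "nat \<Rightarrow> 'a set \<Rightarrow> ('a, 'b) monoid_scheme \<Rightarrow> bool" where
  "p_subgroup p P G \<longleftrightarrow> subgroup P G \<and> (\<forall>x\<in>P. \<exists>n::nat. group.ord G x = p ^ n)"

text \<open>For arbitrary (possibly infinite) groups; the locale \<open>sylow\<close> only covers finite groups.\<close>
definition sylow_subgroup :: "nat \<Rightarrow> 'a set \<Rightarrow> ('a, 'b) monoid_scheme \<Rightarrow> bool" where
  "sylow_subgroup p P G \<longleftrightarrow>
     p_subgroup p P G \<and> (\<forall>Q. p_subgroup p Q G \<and> P \<subseteq> Q \<longrightarrow> Q = P)"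

definition conjugate :: "('a, 'b) monoid_scheme \<Rightarrow> 'a \<Rightarrow> 'a \<Rightarrow> 'a" where
  "conjugate G x a = inv\<^bsub>G\<^esub> a \<otimes>\<^bsub>G\<^esub> x \<otimes>\<^bsub>G\<^esub> a"

definition centralizer_in :: "('a, 'b) monoid_scheme \<Rightarrow> 'a set \<Rightarrow> 'a \<Rightarrow> 'a set" where
  "centralizer_in G H a = {x \<in> H. x \<otimes>\<^bsub>G\<^esub> a = a \<otimes>\<^bsub>G\<^esub> x}"

definition elementary_abelian :: "nat \<Rightarrow> ('a, 'b) monoid_scheme \<Rightarrow> bool" where
  "elementary_abelian p G \<longleftrightarrow> comm_group G \<and> (\<forall>x\<in>carrier G. x [^]\<^bsub>G\<^esub> p = \<one>\<^bsub>G\<^esub>)"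

end

(*
  Every cyclic subnormal subgroup is normal, and normal cyclic subgroups are centralized by all
  commutators, so the Baer radical B has class at most two and all its subgroups are normal in G.
  As G is hyperabelian, the centralizer of B lies in B; in particular G' lies in the centre of B.
  An element g of p-power order acts on the p-elements of B by powers and, by local nilpotency,
  trivially on the elements of order prime to p. If the p-elements of B have bounded exponent,
  then g generates a subnormal subgroup, so g lies in B. If not, the p-elements of B commute, and a
  power automorphism of p-power order of such a group, being a p-adic unit of finite order
  congruent to 1 modulo p, is trivial for odd p and 1 or -1 for p = 2. This p-adic argument is
  replaced by power_map_trivial: an endomorphism sending every element to one of its powers is
  trivial if its kernel has unbounded exponent.
*)
theory Submission
  imports Defs "HOL-Number_Theory.Number_Theory"
begin

section \<open>Commutators and subnormal subgroups\<close>

text \<open>All subgroups of \<open>B\<close> are normal, but \<open>B\<close> may contain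
  quaternion groups, so its 2-elements need not commute. For odd \<open>p\<close> the divisibility
  of \<open>p ^ r choose 2\<close> by \<open>p\<close> excludes this; for the prime 2 commutation
  has to come from elements of large order. Hence all of (ii) rests on unboundedness, which is
  available because subgroups of \<open>B\<close> have class at most two and so a non-nilpotent
  \<open>D\<close> is not contained in \<open>B\<close>.

  The exponent by which \<open>g\<close> acts on one element \<open>v\<close> is known only modulo
  the order of \<open>v\<close>, so no p-adic unit is at hand. Lifting the exponent determines it up
  to a factor \<open>p ^ (e + 1)\<close> that depends on the order of \<open>g\<close> alone.
  Replacing \<open>v\<close> by its power with this exponent gives an element that \<open>g\<close>
  fixes or inverts, and its order is still large if that of \<open>v\<close> was. It remains to pass
  from some elements of large order to all \<open>p\<close>-elements; this is what
  \<open>power_map_trivial\<close> does, applied to the commutator with \<open>g\<close> and to the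
  product of \<open>g x g^-1\<close> and \<open>x\<close>.\<close>

context group
begin

lemma inv_mult_cancel: "x \<in> carrier G \<Longrightarrow> y \<in> carrier G \<Longrightarrow> inv x \<otimes> (x \<otimes> y) = y"
  by (simp flip: m_assoc)

lemma mult_inv_cancel: "x \<in> carrier G \<Longrightarrow> y \<in> carrier G \<Longrightarrow> x \<otimes> (inv x \<otimes> y) = y"
  by (simp flip: m_assoc)

lemmas word_simps = m_assoc inv_mult_group inv_mult_cancel mult_inv_cancel

text \<open>With this order of the factors \<open>commutator x y \<otimes> y\<close> is the
  conjugate of \<open>y\<close> by \<open>x\<close>. Actions in the proof are
  \<open>g \<otimes> x \<otimes> inv g\<close>, opposite to \<open>conjugate\<close> in the
  theorem.\<close>

definition commutator :: "'a \<Rightarrow> 'a \<Rightarrow> 'a" where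
  "commutator x y = x \<otimes> y \<otimes> inv x \<otimes> inv y"

lemma commutator_closed [simp, intro]:
  "x \<in> carrier G \<Longrightarrow> y \<in> carrier G \<Longrightarrow> commutator x y \<in> carrier G"
  by (simp add: commutator_def)

lemma commutator_eq_one_iff:
  assumes "x \<in> carrier G" "y \<in> carrier G"
  shows "commutator x y = \<one> \<longleftrightarrow> x \<otimes> y = y \<otimes> x"
proof
  assume "commutator x y = \<one>"
  then have "commutator x y \<otimes> (y \<otimes> x) = y \<otimes> x" using assms by simp
  then show "x \<otimes> y = y \<otimes> x" using assms by (simp add: commutator_def word_simps)
next
  assume *: "x \<otimes> y = y \<otimes> x"
  show "commutator x y = \<one>" unfolding commutator_def * using assms by (simp add: word_simps)
qed

lemma commutes_mult:
  assumes "x \<otimes> z = z \<otimes> x" "y \<otimes> z = z \<otimes> y" "x \<in> carrier G" "y \<in> carrier G" "z \<in> carrier G"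
  shows "x \<otimes> y \<otimes> z = z \<otimes> (x \<otimes> y)"
proof -
  have "x \<otimes> y \<otimes> z = x \<otimes> (z \<otimes> y)" using assms by (simp add: m_assoc)
  also have "\<dots> = z \<otimes> (x \<otimes> y)" using assms by (simp flip: m_assoc)
  finally show ?thesis .
qed

lemma commutes_inv:
  assumes "x \<otimes> z = z \<otimes> x" "x \<in> carrier G" "z \<in> carrier G"
  shows "inv x \<otimes> z = z \<otimes> inv x"
proof -
  have "inv x \<otimes> z = inv x \<otimes> (z \<otimes> x) \<otimes> inv x" using assms(2,3) by (simp add: m_assoc)
  also have "\<dots> = z \<otimes> inv x" unfolding assms(1)[symmetric] using assms(2,3) by (simp add: word_simps)
  finally show ?thesis .
qed

lemma commutes_nat_pow:
  assumes "x \<otimes> z = z \<otimes> x" "x \<in> carrier G" "z \<in> carrier G"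
  shows "x [^] (n::nat) \<otimes> z = z \<otimes> x [^] n"
  using assms by (rule group_commutes_pow)

lemma commutes_int_pow:
  assumes "x \<otimes> z = z \<otimes> x" "x \<in> carrier G" "z \<in> carrier G"
  shows "x [^] (n::int) \<otimes> z = z \<otimes> x [^] n"
proof (cases n rule: int_cases2)
  case (nonneg m)
  then show ?thesis using commutes_nat_pow[OF assms] by (simp only: int_pow_int)
next
  case (nonpos m)
  then show ?thesis
    using commutes_inv[OF commutes_nat_pow[OF assms]] assms(2,3)
    by (simp only: int_pow_neg_int nat_pow_closed)
qed

lemma conj_nat_pow:
  assumes "g \<in> carrier G" "x \<in> carrier G"
  shows "(g \<otimes> x \<otimes> inv g) [^] (n::nat) = g \<otimes> x [^] n \<otimes> inv g"
proof (induction n)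
  case (Suc n)
  then show ?case using assms by (simp add: word_simps)
qed (use assms in simp)

lemma conj_int_pow:
  assumes "g \<in> carrier G" "x \<in> carrier G"
  shows "(g \<otimes> x \<otimes> inv g) [^] (n::int) = g \<otimes> x [^] n \<otimes> inv g"
proof (cases n rule: int_cases2)
  case (nonneg m)
  then show ?thesis using conj_nat_pow[OF assms] by (simp only: int_pow_int)
next
  case (nonpos m)
  have "inv (g \<otimes> x [^] m \<otimes> inv g) = g \<otimes> inv (x [^] m) \<otimes> inv g"
    using assms by (simp add: word_simps)
  with nonpos show ?thesis
    using conj_nat_pow[OF assms] assms by (simp only: int_pow_neg_int m_closed inv_closed)
qed

lemma centralizer_subgroup:
  assumes "subgroup N G" "x \<in> carrier G"
  shows "subgroup {y \<in> N. y \<otimes> x = x \<otimes> y} G"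
proof -
  interpret N: subgroup N G by fact
  show ?thesis
  proof (rule subgroupI)
    show "{y \<in> N. y \<otimes> x = x \<otimes> y} \<noteq> {}" using assms(2) by (auto intro!: exI[of _ \<one>])
  qed (use assms(2) in \<open>auto intro: commutes_inv commutes_mult\<close>)
qed

lemma generate_commutes:
  assumes "b \<in> generate G S" "S \<subseteq> carrier G" "z \<in> carrier G"
    "\<And>s. s \<in> S \<Longrightarrow> s \<otimes> z = z \<otimes> s"
  shows "b \<otimes> z = z \<otimes> b"
  using assms(1)
proof (induction rule: generate.induct)
  case (eng h1 h2)
  then show ?case using assms generate_in_carrier by (metis commutes_mult)
qed (use assms in \<open>auto intro: commutes_inv\<close>)

lemma int_pow_in_generate:
  "x \<in> carrier G \<Longrightarrow> x [^] (k::int) \<in> generate G {x}"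
  using generate_pow by blast

lemma generate_singleton:
  assumes "x \<in> carrier G"
  shows "generate G {x} = {x [^] (k::int) | k. True}"
  using generate_pow[OF assms] by auto

section \<open>Subnormal series built downwards\<close>

lemma normal_of_conj_closed:
  assumes "subgroup H G" "subgroup K G" "H \<subseteq> K"
    and "\<And>k h. k \<in> K \<Longrightarrow> h \<in> H \<Longrightarrow> k \<otimes> h \<otimes> inv k \<in> H"
  shows "H \<lhd> G\<lparr>carrier := K\<rparr>"
proof -
  interpret K: group "G\<lparr>carrier := K\<rparr>" using assms(2) by (rule subgroup.subgroup_is_group) (rule is_group)
  have "subgroup H (G\<lparr>carrier := K\<rparr>)"
    using assms(1-3) by (rule subgroup_incl)
  then show ?thesis
    by (rule K.normal_invI) (use assms in \<open>auto simp: m_inv_consistent\<close>)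
qed

text \<open>A chain is prolonged at its lower end, so a series can be built down from a normal
  subgroup without naming all its terms.\<close>

lemma subnormal_step:
  assumes "subgroup H G" "subgroup K G" "H \<subseteq> K"
    and "\<And>k h. k \<in> K \<Longrightarrow> h \<in> H \<Longrightarrow> k \<otimes> h \<otimes> inv k \<in> H"
    and "subnormal_subgroup K G"
  shows "subnormal_subgroup H G"
proof -
  obtain n C where C: "C 0 = K" "C n = carrier G" "\<forall>i\<le>n. subgroup (C i) G"
    "\<forall>i<n. C i \<lhd> G\<lparr>carrier := C (Suc i)\<rparr>"
    using assms(5) unfolding subnormal_subgroup_def by auto
  define C' where "C' = (\<lambda>i. case i of 0 \<Rightarrow> H | Suc j \<Rightarrow> C j)"
  have "H \<lhd> G\<lparr>carrier := K\<rparr>" using normal_of_conj_closed assms by blast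
  then have "C' 0 = H \<and> C' (Suc n) = carrier G \<and> (\<forall>i\<le>Suc n. subgroup (C' i) G) \<and>
        (\<forall>i<Suc n. C' i \<lhd> G\<lparr>carrier := C' (Suc i)\<rparr>)"
    using C assms(1) by (auto simp: C'_def split: nat.splits)
  then show ?thesis unfolding subnormal_subgroup_def by blast
qed

lemma subnormal_carrier: "subnormal_subgroup (carrier G) G"
  unfolding subnormal_subgroup_def
  by (intro exI[of _ 0] exI[of _ "\<lambda>_. carrier G"]) (simp add: subgroup_self)

lemma subnormal_normal: "H \<lhd> G \<Longrightarrow> subnormal_subgroup H G"
  by (rule subnormal_step[OF _ subgroup_self _ _ subnormal_carrier])
     (auto simp: normal_inv_iff subgroup.subset subgroup.mem_carrier)

lemma subnormal_imp_subgroup: "subnormal_subgroup H G \<Longrightarrow> subgroup H G"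
  unfolding subnormal_subgroup_def by auto

lemma subgroup_mem_nat_pow:
  "subgroup H G \<Longrightarrow> x \<in> H \<Longrightarrow> x [^] (k::nat) \<in> H"
  using subgroup_int_pow_closed[of H x "int k"] by (simp add: int_pow_int)

lemma conj_closed_generate:
  assumes "S \<subseteq> carrier G" "t \<in> carrier G" "h \<in> generate G S"
    "\<And>s. s \<in> S \<Longrightarrow> t \<otimes> s \<otimes> inv t \<in> generate G S"
  shows "t \<otimes> h \<otimes> inv t \<in> generate G S"
  using assms(3)
proof (induction rule: generate.induct)
  case one
  then show ?case using assms generate.one by simp
next
  case (incl h)
  then show ?case using assms by simp
next
  case (inv h)
  then have "inv (t \<otimes> h \<otimes> inv t) \<in> generate G S"
    using assms generate_m_inv_closed by blast
  moreover have "h \<in> carrier G" using inv assms by blast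
  ultimately show ?case using assms by (simp add: word_simps)
next
  case (eng h1 h2)
  have "h1 \<in> carrier G" "h2 \<in> carrier G"
    using eng assms generate_in_carrier by auto
  then have "t \<otimes> (h1 \<otimes> h2) \<otimes> inv t = (t \<otimes> h1 \<otimes> inv t) \<otimes> (t \<otimes> h2 \<otimes> inv t)"
    using assms by (simp add: word_simps)
  then show ?case using eng generate.eng by metis
qed

text \<open>Generators suffice, but both \<open>t\<close> and \<open>inv t\<close> must be checked:
  in an infinite group an element may conjugate a subgroup properly into itself.\<close>

lemma subnormal_generate_step:
  assumes "S \<subseteq> T" "T \<subseteq> carrier G"
    and conj: "\<And>t s. t \<in> T \<Longrightarrow> s \<in> S \<Longrightarrow> t \<otimes> s \<otimes> inv t \<in> generate G S"
    and conj': "\<And>t s. t \<in> T \<Longrightarrow> s \<in> S \<Longrightarrow> inv t \<otimes> s \<otimes> t \<in> generate G S"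
    and "subnormal_subgroup (generate G T) G"
  shows "subnormal_subgroup (generate G S) G"
proof (rule subnormal_step)
  have S: "S \<subseteq> carrier G" using assms by blast
  show "subgroup (generate G S) G" "subgroup (generate G T) G"
    using S assms(2) by (auto intro: generate_is_subgroup)
  show "generate G S \<subseteq> generate G T" by (rule mono_generate) fact
  fix k h assume "k \<in> generate G T" and h: "h \<in> generate G S"
  then show "k \<otimes> h \<otimes> inv k \<in> generate G S"
  proof (induction arbitrary: h rule: generate.induct)
    case one
    then show ?case using generate_in_carrier[OF S] by simp
  next
    case (incl t)
    then show ?case using conj_closed_generate S assms by blast
  next
    case (inv t)
    then have "t \<in> carrier G" using assms by blast
    then show ?case
      using conj_closed_generate[OF S inv_closed inv(2)] conj' inv by simp
  next
    case (eng h1 h2)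
    have c: "h1 \<in> carrier G" "h2 \<in> carrier G" "h \<in> carrier G"
      using eng assms(2) S generate_in_carrier by auto
    have "h1 \<otimes> (h2 \<otimes> h \<otimes> inv h2) \<otimes> inv h1 \<in> generate G S" using eng by blast
    then show ?case using c by (simp add: word_simps)
  qed
qed (fact assms(5))

text \<open>Normality of the cyclic subgroup of \<open>x\<close>, put elementwise so that the action
  of \<open>g\<close> becomes an integer. Elements of infinite order are still allowed here.\<close>

definition cyclic_normal :: "'a \<Rightarrow> bool" where
  "cyclic_normal x \<longleftrightarrow>
     x \<in> carrier G \<and> (\<forall>g\<in>carrier G. \<exists>k::int. g \<otimes> x \<otimes> inv g = x [^] k)"

lemma cyclic_normal_iff:
  assumes "x \<in> carrier G"
  shows "cyclic_normal x \<longleftrightarrow> generate G {x} \<lhd> G"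
proof
  assume "generate G {x} \<lhd> G"
  then have "g \<otimes> x \<otimes> inv g \<in> generate G {x}" if "g \<in> carrier G" for g
    using that assms generate.incl[of x "{x}" G] by (auto simp: normal_inv_iff)
  then show "cyclic_normal x"
    using assms unfolding cyclic_normal_def generate_singleton[OF assms] by blast
next
  assume x: "cyclic_normal x"
  show "generate G {x} \<lhd> G"
  proof (rule normal_invI)
    show "subgroup (generate G {x}) G" using assms by (simp add: generate_is_subgroup)
    fix g h assume g: "g \<in> carrier G" and "h \<in> generate G {x}"
    then obtain l where h: "h = x [^] (l::int)" using assms by (auto simp: generate_singleton)
    obtain k where "g \<otimes> x \<otimes> inv g = x [^] (k::int)" using x g unfolding cyclic_normal_def by blast
    then have "g \<otimes> h \<otimes> inv g = x [^] (k * l)"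
      using conj_int_pow[OF g assms, of l] assms by (simp add: h int_pow_pow)
    then show "g \<otimes> h \<otimes> inv g \<in> generate G {x}" using assms int_pow_in_generate by simp
  qed
qed

text \<open>The automorphism group of a cyclic group is abelian: the exponents of
  \<open>inv g\<close> and \<open>inv h\<close> are multiplied in either order.\<close>

lemma commutator_commutes_cyclic_normal:
  assumes x: "cyclic_normal x" and g: "g \<in> carrier G" and h: "h \<in> carrier G"
  shows "commutator g h \<otimes> x = x \<otimes> commutator g h"
proof -
  have xc: "x \<in> carrier G" using x by (simp add: cyclic_normal_def)
  obtain k where k: "inv g \<otimes> x \<otimes> g = x [^] (k::int)"
    using x g unfolding cyclic_normal_def by (metis inv_closed inv_inv)
  obtain l where l: "inv h \<otimes> x \<otimes> h = x [^] (l::int)"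
    using x h unfolding cyclic_normal_def by (metis inv_closed inv_inv)
  have "inv g \<otimes> (inv h \<otimes> x \<otimes> h) \<otimes> g = x [^] (k * l)"
    using conj_int_pow[of "inv g" x l] g xc by (simp add: l k int_pow_pow)
  moreover have "inv h \<otimes> (inv g \<otimes> x \<otimes> g) \<otimes> h = x [^] (k * l)"
    using conj_int_pow[of "inv h" x k] h xc by (simp add: l k int_pow_pow mult.commute)
  ultimately have eq: "inv g \<otimes> (inv h \<otimes> x \<otimes> h) \<otimes> g = inv h \<otimes> (inv g \<otimes> x \<otimes> g) \<otimes> h"
    by simp
  have "commutator g h \<otimes> x = g \<otimes> h \<otimes> (inv g \<otimes> (inv h \<otimes> x \<otimes> h) \<otimes> g) \<otimes> inv g \<otimes> inv h"
    using g h xc by (simp add: commutator_def word_simps)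
  also have "\<dots> = x \<otimes> commutator g h"
    unfolding eq using g h xc by (simp add: commutator_def word_simps)
  finally show ?thesis .
qed

lemma conj_closed_of_commutator_closed:
  assumes "subgroup N G" "subgroup K G" "K \<subseteq> N"
    "\<And>x y. x \<in> N \<Longrightarrow> y \<in> K \<Longrightarrow> commutator x y \<in> K" "x \<in> N" "y \<in> K"
  shows "x \<otimes> y \<otimes> inv x \<in> K"
proof -
  have c: "x \<in> carrier G" "y \<in> carrier G" using assms subgroup.mem_carrier by fastforce+
  have "commutator x y \<otimes> y \<in> K" using assms subgroup.m_closed by fast
  then show ?thesis using c by (simp add: commutator_def word_simps)
qed

text \<open>The centralizer of \<open>x\<close> in \<open>N\<close> contains the commutators of \<open>N\<close>, so it is normal in \<open>N\<close>.\<close>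
lemma subnormal_cyclic_of_class_two:
  assumes N: "N \<lhd> G" and x: "x \<in> N"
    and class_two: "\<And>u v z. u \<in> N \<Longrightarrow> v \<in> N \<Longrightarrow> z \<in> N \<Longrightarrow>
      commutator u v \<otimes> z = z \<otimes> commutator u v"
  shows "subnormal_subgroup (generate G {x}) G"
proof -
  have sN: "subgroup N G" using N by (rule normal_imp_subgroup)
  have xc: "x \<in> carrier G" using sN x by (rule subgroup.mem_carrier)
  define K where "K = {y \<in> N. y \<otimes> x = x \<otimes> y}"
  have sK: "subgroup K G" unfolding K_def using sN xc by (rule centralizer_subgroup)
  have "commutator u v \<in> N" if "u \<in> N" "v \<in> N" for u v
    unfolding commutator_def using that sN by (intro subgroup.m_closed subgroup.m_inv_closed)
  then have K: "subnormal_subgroup K G"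
    using class_two x
    by (intro subnormal_step[OF sK sN _ _ subnormal_normal[OF N]]
        conj_closed_of_commutator_closed[OF sN sK]) (auto simp: K_def)
  have gK: "generate G {x} \<subseteq> K"
    using generate_subgroup_incl[OF _ sK] x by (simp add: K_def)
  show ?thesis
  proof (rule subnormal_step[OF _ sK gK _ K])
    show "subgroup (generate G {x}) G" using xc by (simp add: generate_is_subgroup)
    fix k h assume k: "k \<in> K" and h: "h \<in> generate G {x}"
    have kc: "k \<in> carrier G" using sK k by (rule subgroup.mem_carrier)
    obtain l where "h = x [^] (l::int)" using h xc by (auto simp: generate_singleton)
    then have "h \<otimes> k = k \<otimes> h" using k xc kc by (auto simp: K_def intro: commutes_int_pow)
    then have "k \<otimes> h \<otimes> inv k = h"
      using kc xc h generate_in_carrier[of "{x}" h] by (metis inv_solve_right empty_subsetI insert_subset m_closed)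
    then show "k \<otimes> h \<otimes> inv k \<in> generate G {x}" using h by simp
  qed
qed

lemma commutator_mem_of_coset_commute:
  assumes "H \<lhd> G" "x \<in> carrier G" "y \<in> carrier G"
    and "(H #> x) <#> (H #> y) = (H #> y) <#> (H #> x)"
  shows "commutator x y \<in> H"
proof -
  interpret H: normal H G by fact
  have "H #> (x \<otimes> y) = H #> (y \<otimes> x)" using assms by (simp add: H.rcos_sum)
  then have "x \<otimes> y \<in> H #> (y \<otimes> x)"
    using rcos_self[OF m_closed[OF assms(2,3)] H.subgroup_axioms] by simp
  then obtain h where "h \<in> H" "x \<otimes> y = h \<otimes> (y \<otimes> x)" by (auto simp: r_coset_def)
  moreover from this have "commutator x y = h"
    using assms(2,3) H.mem_carrier[of h] unfolding commutator_def by (simp add: word_simps)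
  ultimately show ?thesis by simp
qed

lemma consecutive_factor_commutator:
  assumes "H \<lhd> G" "K \<lhd> G" "H \<subseteq> K" and comm: "comm_group (G\<lparr>carrier := K\<rparr> Mod H)"
    and x: "x \<in> K" and y: "y \<in> K"
  shows "commutator x y \<in> H"
proof -
  interpret H: normal H G by fact
  have c: "x \<in> carrier G" "y \<in> carrier G"
    using assms(2) x y normal_imp_subgroup subgroup.mem_carrier by metis+
  have coset: "r_coset (G\<lparr>carrier := K\<rparr>) H z = H #> z" for z by (simp add: r_coset_def)
  have car: "carrier (G\<lparr>carrier := K\<rparr> Mod H) = (\<lambda>x. H #> x) ` K"
    by (simp add: carrier_FactGroup coset)
  have mlt: "monoid.mult (G\<lparr>carrier := K\<rparr> Mod H) = set_mult G"
    by (simp add: set_mult_def fun_eq_iff)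
  have "(H #> x) <#> (H #> y) = (H #> y) <#> (H #> x)"
    using comm_monoid.m_comm[OF comm_group.axioms(1)[OF comm], of "H #> x" "H #> y"] x y
    unfolding car mlt by blast
  then show ?thesis using commutator_mem_of_coset_commute assms(1) c by blast
qed

end

section \<open>The Baer radical\<close>

locale abelian_subnormals_normal = group G for G (structure) +
  assumes abelian_subnormal_normal:
    "subnormal_subgroup A G \<Longrightarrow> comm_group (G\<lparr>carrier := A\<rparr>) \<Longrightarrow> A \<lhd> G"
begin

abbreviation B where "B \<equiv> baer_radical G"

text \<open>A cyclic group is abelian, so subnormality becomes normality. The hypothesis on abelian
  subnormal subgroups enters the proof only here.\<close>

lemma subnormal_cyclic:
  assumes x: "x \<in> carrier G" and sub: "subnormal_subgroup (generate G {x}) G"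
  shows "cyclic_normal x" "x \<in> B"
proof -
  let ?C = "G\<lparr>carrier := generate G {x}\<rparr>"
  have sC: "subgroup (generate G {x}) G" using x by (simp add: generate_is_subgroup)
  interpret C: group ?C using sC by (rule subgroup.subgroup_is_group) (rule is_group)
  have xC: "x \<in> generate G {x}" by (simp add: generate.incl)
  have "range (\<lambda>n::int. x [^]\<^bsub>?C\<^esub> n) = range (\<lambda>n::int. x [^] n)"
    by (simp only: int_pow_consistent[OF sC xC])
  also have "\<dots> = carrier ?C" by (auto simp: generate_singleton[OF x])
  finally have "carrier ?C = range (\<lambda>n::int. x [^]\<^bsub>?C\<^esub> n)" by (rule sym)
  then have cyc: "cyclic_group ?C" unfolding C.cyclic_group using xC by auto
  then have "comm_group ?C" by (rule C.cyclic_imp_abelian_group)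
  then show "cyclic_normal x"
    using abelian_subnormal_normal sub x by (simp add: cyclic_normal_iff)
  show "x \<in> B" unfolding baer_radical_def
    using cyc sub xC by (intro generate.incl) blast
qed

text \<open>Passes from generating subgroups to generating elements: every subgroup of an abelian
  subnormal \<open>H\<close> is normal in \<open>H\<close>, so each element of \<open>H\<close>
  generates a subnormal subgroup itself.\<close>

lemma baer_radical_generated:
  obtains S where "B = generate G S" "S \<subseteq> carrier G" "\<And>s. s \<in> S \<Longrightarrow> cyclic_normal s"
proof
  let ?S = "\<Union>{H. subnormal_subgroup H G \<and> cyclic_group (G\<lparr>carrier := H\<rparr>)}"
  show "B = generate G ?S" by (simp add: baer_radical_def)
  show sub: "?S \<subseteq> carrier G" using subnormal_imp_subgroup subgroup.subset by blast
  fix s assume s: "s \<in> ?S"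
  then obtain H where H: "s \<in> H" "subnormal_subgroup H G" "cyclic_group (G\<lparr>carrier := H\<rparr>)"
    by blast
  have sH: "subgroup H G" using H(2) by (rule subnormal_imp_subgroup)
  interpret H: group "G\<lparr>carrier := H\<rparr>"
    using sH by (rule subgroup.subgroup_is_group) (rule is_group)
  have "comm_group (G\<lparr>carrier := H\<rparr>)" using H(3) by (rule H.cyclic_imp_abelian_group)
  then have comm: "x \<otimes> y = y \<otimes> x" if "x \<in> H" "y \<in> H" for x y
    using comm_monoid.m_comm[OF comm_group.axioms(1), of "G\<lparr>carrier := H\<rparr>" x y] that by simp
  have sc: "s \<in> carrier G" using s sub by blast
  have gH: "generate G {s} \<subseteq> H" using generate_subgroup_incl[OF _ sH] H(1) by simp
  have "subnormal_subgroup (generate G {s}) G"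
  proof (rule subnormal_step[OF _ sH gH _ H(2)])
    show "subgroup (generate G {s}) G" using sc by (simp add: generate_is_subgroup)
    fix k h assume k: "k \<in> H" and h: "h \<in> generate G {s}"
    have "k \<otimes> h = h \<otimes> k" using k h gH comm by blast
    moreover have "k \<in> carrier G" "h \<in> carrier G"
      using k h gH subgroup.mem_carrier[OF sH] by auto
    ultimately have "k \<otimes> h \<otimes> inv k = h" by (metis inv_solve_right m_closed)
    then show "k \<otimes> h \<otimes> inv k \<in> generate G {s}" using h by simp
  qed
  then show "cyclic_normal s" using subnormal_cyclic sc by blast
qed

lemma commutator_centralizes_baer_radical:
  assumes "g \<in> carrier G" "h \<in> carrier G" "b \<in> B"
  shows "commutator g h \<otimes> b = b \<otimes> commutator g h"
proof -
  obtain S where S: "B = generate G S" "S \<subseteq> carrier G" "\<And>s. s \<in> S \<Longrightarrow> cyclic_normal s"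
    using baer_radical_generated by blast
  have "b \<otimes> commutator g h = commutator g h \<otimes> b"
    using assms S by (intro generate_commutes[of b S])
      (auto simp: commutator_commutes_cyclic_normal)
  then show ?thesis by simp
qed

lemma baer_radical_normal: "B \<lhd> G"
proof -
  obtain S where S: "B = generate G S" "S \<subseteq> carrier G" "\<And>s. s \<in> S \<Longrightarrow> cyclic_normal s"
    using baer_radical_generated by blast
  show ?thesis
  proof (rule normal_invI)
    show "subgroup B G" using S generate_is_subgroup by simp
    fix g h assume g: "g \<in> carrier G" and h: "h \<in> B"
    have "g \<otimes> s \<otimes> inv g \<in> generate G S" if s: "s \<in> S" for s
    proof -
      obtain k where "g \<otimes> s \<otimes> inv g = s [^] (k::int)"
        using S(3)[OF s] g unfolding cyclic_normal_def by blast
      then show ?thesis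
        using subgroup_int_pow_closed[OF generate_is_subgroup[OF S(2)], of s k] s
        by (simp add: generate.incl)
    qed
    then show "g \<otimes> h \<otimes> inv g \<in> B"
      using conj_closed_generate[OF S(2) g, of h] h S(1) by simp
  qed
qed

lemma baer_radical_subgroup: "subgroup B G"
  using baer_radical_normal by (rule normal_imp_subgroup)

lemma baer_radical_carrier [simp]: "b \<in> B \<Longrightarrow> b \<in> carrier G"
  using baer_radical_subgroup by (rule subgroup.mem_carrier)

text \<open>Extends normality from the generators to all elements: commutators centralize
  \<open>B\<close>, so \<open>B\<close> has class at most two and its cyclic subgroups are
  subnormal.\<close>

lemma baer_radical_cyclic_normal:
  assumes "b \<in> B"
  shows "cyclic_normal b"
proof -
  have "subnormal_subgroup (generate G {b}) G"
    using baer_radical_normal assms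
    by (rule subnormal_cyclic_of_class_two) (simp add: commutator_centralizes_baer_radical)
  then show ?thesis using subnormal_cyclic assms by simp
qed

text \<open>Otherwise let \<open>H\<close> be the least term of the series whose intersection \<open>A\<close> with the
  centralizer leaves the Baer radical. Then \<open>A\<close> is normal of class two, as its commutators lie in
  an earlier term, hence in the Baer radical.\<close>
lemma centralizer_le_baer_radical:
  assumes "hyperabelian G"
    and c: "c \<in> carrier G" "\<And>b. b \<in> B \<Longrightarrow> c \<otimes> b = b \<otimes> c"
  shows "c \<in> B"
proof (rule ccontr)
  assume cB: "c \<notin> B"
  obtain S where S: "ascending_normal_series G S"
    "\<And>H K. consecutive_terms S H K \<Longrightarrow> comm_group (G\<lparr>carrier := K\<rparr> Mod H)"
    using assms(1) unfolding hyperabelian_def by blast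
  have norm: "H \<lhd> G" if "H \<in> S" for H using that S(1) by (simp add: ascending_normal_series_def)
  define C where "C = {x \<in> carrier G. \<forall>b\<in>B. x \<otimes> b = b \<otimes> x}"
  have conjC: "g \<otimes> x \<otimes> inv g \<in> C" if g: "g \<in> carrier G" and x: "x \<in> C" for g x
  proof -
    have xc: "x \<in> carrier G" using x by (simp add: C_def)
    have "g \<otimes> x \<otimes> inv g \<otimes> b = b \<otimes> (g \<otimes> x \<otimes> inv g)" if b: "b \<in> B" for b
    proof -
      have b': "inv g \<otimes> b \<otimes> g \<in> B"
        using baer_radical_normal g b normal.inv_op_closed1 by fastforce
      have "g \<otimes> x \<otimes> inv g \<otimes> b = g \<otimes> (x \<otimes> (inv g \<otimes> b \<otimes> g)) \<otimes> inv g"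
        using g xc b by (simp add: word_simps)
      also have "\<dots> = g \<otimes> ((inv g \<otimes> b \<otimes> g) \<otimes> x) \<otimes> inv g"
        using x b' by (simp add: C_def)
      also have "\<dots> = b \<otimes> (g \<otimes> x \<otimes> inv g)"
        using g xc b by (simp add: word_simps)
      finally show ?thesis .
    qed
    then show ?thesis using g xc by (simp add: C_def)
  qed
  have sC: "subgroup C G"
  proof (rule subgroupI)
    show "C \<noteq> {}" by (auto simp: C_def intro!: exI[of _ \<one>])
  qed (auto simp: C_def intro: commutes_inv commutes_mult)
  have nC: "C \<lhd> G" by (rule normal_invI[OF sC conjC])
  define T where "T = {H \<in> S. \<not> H \<inter> C \<subseteq> B}"
  have "c \<in> carrier G \<inter> C" unfolding C_def using c by blast
  moreover have "carrier G \<in> S" using S(1) by (simp add: ascending_normal_series_def)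
  ultimately have "carrier G \<in> T" using cB unfolding T_def by blast
  then have "T \<subseteq> S" "T \<noteq> {}" by (auto simp: T_def)
  then obtain H where H: "H \<in> T" "\<And>K. K \<in> T \<Longrightarrow> H \<subseteq> K"
    using S(1) unfolding ascending_normal_series_def by metis
  \<comment> \<open>Each term below \<open>H\<close> meets \<open>C\<close> inside \<open>B\<close>,
    hence so does their union. The union therefore differs from \<open>H\<close>: the term
    \<open>H\<close> is not a limit, and the union is its predecessor. The series is closed only
    under nonempty unions, so \<open>{\<one>}\<close> is needed as a member of
    \<open>U\<close>.\<close>
  define U where "U = {K \<in> S. K \<subset> H}"
  have HS: "H \<in> S" using H by (simp add: T_def)
  have oneS: "{\<one>} \<in> S" using S(1) by (simp add: ascending_normal_series_def)
  have "\<one> \<in> B" using baer_radical_subgroup by (rule subgroup.one_closed)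
  then have "H \<noteq> {\<one>}" using H(1) by (auto simp: T_def)
  moreover have "\<one> \<in> H"
    using norm[OF HS] by (intro subgroup.one_closed normal_imp_subgroup)
  ultimately have "{\<one>} \<in> U" using oneS by (auto simp: U_def)
  then have "U \<noteq> {}" "U \<subseteq> S" by (auto simp: U_def)
  then have US: "\<Union>U \<in> S" using S(1) unfolding ascending_normal_series_def by simp
  have UB: "\<Union>U \<inter> C \<subseteq> B"
  proof -
    have "K \<inter> C \<subseteq> B" if "K \<in> U" for K
      using that H(2)[of K] by (auto simp: U_def T_def)
    then show ?thesis by blast
  qed
  then have UH: "\<Union>U \<subset> H" using H(1) by (auto simp: U_def T_def)
  have "consecutive_terms S (\<Union>U) H"
    using US HS UH unfolding consecutive_terms_def by (auto simp: U_def)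
  then have comm: "comm_group (G\<lparr>carrier := H\<rparr> Mod \<Union>U)" by (rule S(2))
  have nA: "H \<inter> C \<lhd> G" using norm[OF HS] nC by (rule normal_subgroup_intersect)
  have AB: "x \<in> B" if x: "x \<in> H \<inter> C" for x
  proof -
    have "subnormal_subgroup (generate G {x}) G"
    proof (rule subnormal_cyclic_of_class_two[OF nA x])
      fix u v z assume uvz: "u \<in> H \<inter> C" "v \<in> H \<inter> C" "z \<in> H \<inter> C"
      have "commutator u v \<in> \<Union>U"
        using consecutive_factor_commutator[OF norm[OF US] norm[OF HS] _ comm] UH uvz by blast
      moreover have "commutator u v \<in> C"
        unfolding commutator_def
        using uvz sC by (auto intro!: subgroup.m_closed subgroup.m_inv_closed)
      ultimately have "commutator u v \<in> B" using UB by blast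
      then show "commutator u v \<otimes> z = z \<otimes> commutator u v" using uvz by (simp add: C_def)
    qed
    then show ?thesis using subnormal_cyclic x by (auto simp: C_def)
  qed
  then show False using H(1) by (auto simp: T_def)
qed

end

section \<open>Power automorphisms and elements of prime power order\<close>

lemma fermat_theorem_int:
  fixes p :: nat and k :: int
  assumes "Factorial_Ring.prime p"
  shows "[k ^ p = k] (mod int p)"
proof -
  define a where "a = nat (k mod int p)"
  have p: "p > 0" using assms by (rule prime_gt_0_nat)
  then have ka: "[k = int a] (mod int p)" by (simp add: a_def cong_def)
  have "[a ^ p = a] (mod p)"
  proof (cases "p dvd a")
    case True
    then have "p dvd a ^ p" using p by (simp add: dvd_power_le dvd_trans)
    then show ?thesis using True by (simp add: cong_def mod_eq_0_iff_dvd)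
  next
    case False
    then have "[a * a ^ (p - 1) = a * 1] (mod p)"
      using assms by (intro cong_mult cong_refl fermat_theorem)
    then show ?thesis using p by (metis mult.right_neutral power_eq_if not_gr_zero)
  qed
  then have "[int a ^ p = int a] (mod int p)" by (metis cong_int_iff of_nat_power)
  then show ?thesis using ka by (meson cong_pow cong_sym cong_trans)
qed

lemma fermat_theorem_int_power:
  fixes p :: nat and k :: int
  assumes "Factorial_Ring.prime p"
  shows "[k ^ (p ^ e) = k] (mod int p)"
proof (induction e)
  case (Suc e)
  have "[(k ^ (p ^ e)) ^ p = k ^ (p ^ e)] (mod int p)" by (rule fermat_theorem_int) fact
  then show ?case using Suc by (metis cong_trans power_Suc2 power_mult)
qed simp

text \<open>For \<open>k\<close> other than 1 the sum is the quotient of \<open>k ^ p - 1\<close> by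
  \<open>k - 1\<close>. With \<open>k = 1 + p * t\<close> it is \<open>p\<close> plus
  \<open>p * t\<close> times the sum of all \<open>i < p\<close>, modulo the square of
  \<open>p\<close>, and for odd \<open>p\<close> that sum is a multiple of \<open>p\<close>. For
  \<open>p = 2\<close> it is \<open>1 + k\<close>, which has a single factor 2 only if
  \<open>k\<close> is 1 modulo 4.\<close>

lemma geometric_sum_eq_prime_times_unit:
  fixes p :: nat and k :: int
  assumes p: "Factorial_Ring.prime p" and k: "[k = 1] (mod int p)"
    and four: "p = 2 \<Longrightarrow> [k = 1] (mod 4)"
  obtains u where "(\<Sum>i<p. k ^ i) = int p * u" "coprime u (int p)"
proof (cases "p = 2")
  case True
  then obtain t where t: "k = 1 + 4 * t" using four by (metis cong_iff_lin cong_sym)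
  have "(\<Sum>i<p. k ^ i) = int p * (1 + 2 * t)"
    using True t by (simp add: numeral_2_eq_2)
  moreover have "coprime (1 + 2 * t) (int p)" using True by simp
  ultimately show ?thesis using that by blast
next
  case False
  obtain t where t: "k = 1 + int p * t" using k by (metis cong_iff_lin cong_sym)
  have pow: "[k ^ i = 1 + int p * (int i * t)] (mod (int p)\<^sup>2)" for i
  proof (induction i)
    case (Suc i)
    have "[k ^ Suc i = (1 + int p * (int i * t)) * k] (mod (int p)\<^sup>2)"
      using cong_mult[OF Suc cong_refl[of k]] by (simp add: mult.commute)
    moreover have "(1 + int p * (int i * t)) * k = (1 + int p * (int (Suc i) * t)) + (int p)\<^sup>2 * (int i * t * t)"
      by (simp add: t algebra_simps power2_eq_square)
    ultimately show ?case by (simp add: cong_def)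
  qed simp
  have "[(\<Sum>i<p. k ^ i) = (\<Sum>i<p. 1 + int p * (int i * t))] (mod (int p)\<^sup>2)"
    by (rule cong_sum) (rule pow)
  also have "(\<Sum>i<p. 1 + int p * (int i * t)) = int p + int p * t * (\<Sum>i<p. int i)"
    by (simp add: sum.distrib sum_distrib_left algebra_simps)
  also have "(\<Sum>i<p. int i) = int p * int ((p - 1) div 2)"
  proof -
    have "odd p" using p False prime_odd_nat primes_dvd_imp_eq two_is_prime_nat by blast
    then obtain q where q: "p = 2 * q + 1" by (rule oddE)
    have "(\<Sum>i<2 * q + 1. int i) = (2 * int q + 1) * int q" by (induction q) (simp_all add: algebra_simps)
    then show ?thesis by (simp add: q)
  qed
  finally have "[(\<Sum>i<p. k ^ i) = int p + (int p)\<^sup>2 * (t * int ((p - 1) div 2))] (mod (int p)\<^sup>2)"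
    by (simp add: power2_eq_square algebra_simps)
  then have "[(\<Sum>i<p. k ^ i) = int p] (mod (int p)\<^sup>2)" by (simp add: cong_def)
  then obtain s where "(\<Sum>i<p. k ^ i) = int p + (int p)\<^sup>2 * s" by (metis cong_iff_lin cong_sym)
  then have "(\<Sum>i<p. k ^ i) = int p * (1 + int p * s)" by (simp add: power2_eq_square algebra_simps)
  moreover have "coprime (1 + int p * s) (int p)"
    by (metis coprime_1_left coprime_iff_gcd_eq_1 gcd.commute gcd_add_mult mult.commute add.commute)
  ultimately show ?thesis using that by blast
qed

text \<open>Lifting the exponent: each \<open>p\<close>-th power costs exactly one factor
  \<open>p\<close>, because the cofactor \<open>u\<close> of the geometric sum is prime to
  \<open>p\<close> and cancels. The induction replaces \<open>k\<close> by
  \<open>k ^ p\<close>.\<close>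

lemma prime_power_dvd_power_diff:
  fixes p :: nat and k :: int
  assumes p: "Factorial_Ring.prime p"
  shows "[k = 1] (mod int p) \<Longrightarrow> (p = 2 \<Longrightarrow> [k = 1] (mod 4)) \<Longrightarrow>
    int p ^ m dvd k ^ (p ^ e) - 1 \<Longrightarrow> int p ^ m dvd int p ^ e * (k - 1)"
proof (induction e arbitrary: k)
  case (Suc e)
  have "int p ^ m dvd (k ^ p) ^ (p ^ e) - 1" using Suc.prems(3) by (simp add: power_mult)
  moreover have "[k ^ p = 1] (mod int p)" using cong_pow[OF Suc.prems(1), of p] by simp
  moreover have "[k ^ p = 1] (mod 4)" if "p = 2" using cong_pow[OF Suc.prems(2)[OF that], of p] by simp
  ultimately have *: "int p ^ m dvd int p ^ e * (k ^ p - 1)" by (rule Suc.IH[rotated 2])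
  obtain u where u: "(\<Sum>i<p. k ^ i) = int p * u" "coprime u (int p)"
    using geometric_sum_eq_prime_times_unit[OF p Suc.prems(1,2)] by blast
  have "k ^ p - 1 = (k - 1) * (int p * u)"
    unfolding u(1)[symmetric] by (rule power_diff_1_eq)
  then have "int p ^ m dvd int p ^ Suc e * (k - 1) * u"
    using * by (simp add: ac_simps)
  moreover have "coprime (int p ^ m) u" using u(2) by (simp add: coprime_commute)
  ultimately show ?case by (simp add: coprime_dvd_mult_left_iff)
qed simp

text \<open>A unipotent action of order prime to \<open>d\<close> is trivial. Here
  \<open>k ^ a - 1\<close> is \<open>k - 1\<close> times a sum congruent to \<open>a\<close> modulo
  \<open>k - 1\<close>, and \<open>a\<close> is invertible modulo \<open>d\<close>; so the exponent
  of nilpotency of \<open>k - 1\<close> drops by one in each step.\<close>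

lemma dvd_diff_one_of_dvd_power:
  fixes d k :: int and a :: nat
  assumes "d dvd k ^ a - 1" "coprime d (int a)"
  shows "d dvd (k - 1) ^ m \<Longrightarrow> d dvd k - 1"
proof (induction m)
  case (Suc m)
  show ?case
  proof (cases m)
    case (Suc n)
    have "[(\<Sum>i<a. k ^ i) = (\<Sum>i<a. 1)] (mod (k - 1))"
    proof (rule cong_sum)
      fix i
      have "[k = 1] (mod (k - 1))" by (simp add: cong_iff_dvd_diff)
      from cong_pow[OF this, of i] show "[k ^ i = 1] (mod (k - 1))" by simp
    qed
    then have "k - 1 dvd (\<Sum>i<a. k ^ i) - int a" by (simp add: cong_iff_dvd_diff)
    then have "(k - 1) ^ m * (k - 1) dvd (k - 1) ^ m * ((\<Sum>i<a. k ^ i) - int a)"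
      by (rule mult_dvd_mono[OF dvd_refl])
    then have "d dvd (k - 1) ^ m * ((\<Sum>i<a. k ^ i) - int a)"
      using Suc.prems by (metis dvd_trans power_Suc2)
    moreover have "d dvd (k - 1) ^ n * ((k - 1) * (\<Sum>i<a. k ^ i))"
      using assms(1) by (simp add: power_diff_1_eq)
    then have "d dvd (k - 1) ^ m * (\<Sum>i<a. k ^ i)" by (simp add: Suc ac_simps)
    ultimately have "d dvd (k - 1) ^ m * int a" by (simp add: right_diff_distrib dvd_diff_right_iff)
    then show ?thesis using assms(2) Suc.IH by (simp add: coprime_dvd_mult_left_iff)
  qed (use Suc.prems in simp)
qed (auto intro: dvd_trans[of d 1])

section \<open>Actions on normal cyclic subgroups, read off from exponents\<close>

context group
begin

lemma conj_int_pow_iterate: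
  assumes "g \<in> carrier G" "x \<in> carrier G" "g \<otimes> x \<otimes> inv g = x [^] (k::int)"
  shows "g [^] (i::nat) \<otimes> x \<otimes> inv (g [^] i) = x [^] (k ^ i)"
proof (induction i)
  case (Suc i)
  have "g [^] Suc i \<otimes> x \<otimes> inv (g [^] Suc i) = g [^] i \<otimes> x [^] k \<otimes> inv (g [^] i)"
    using assms(1,2) by (simp add: word_simps flip: assms(3))
  also have "\<dots> = (x [^] (k ^ i)) [^] k"
    using assms(1,2) by (simp add: Suc.IH flip: conj_int_pow)
  finally show ?case using assms(2) by (simp add: int_pow_pow mult.commute)
qed (use assms in simp)

text \<open>The power \<open>g [^] n\<close> acts with exponent \<open>k ^ n\<close>, and it acts
  trivially. For \<open>x\<close> of infinite order \<open>ord x = 0\<close>, and the divisibility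
  reads \<open>k ^ n = 1\<close>.\<close>

lemma conj_exponent_power:
  assumes "g \<in> carrier G" "x \<in> carrier G" "g \<otimes> x \<otimes> inv g = x [^] (k::int)"
    and "g [^] (n::nat) = \<one>"
  shows "int (ord x) dvd k ^ n - 1"
proof -
  have "x [^] (1::int) = x [^] (k ^ n)"
    using conj_int_pow_iterate[OF assms(1-3), of n] assms(2,4) by simp
  then show ?thesis using int_pow_eq[OF assms(2)] by blast
qed

lemma commutator_eq_int_pow:
  assumes "g \<in> carrier G" "x \<in> carrier G" "g \<otimes> x \<otimes> inv g = x [^] (k::int)"
  shows "commutator x g = x [^] (1 - k)"
proof -
  have "commutator x g = x \<otimes> inv (g \<otimes> x \<otimes> inv g)"
    using assms(1,2) by (simp add: commutator_def word_simps)
  then show ?thesis using assms by (simp add: int_pow_diff)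
qed

lemma conj_eq_iff_commutes:
  assumes "g \<in> carrier G" "x \<in> carrier G"
  shows "g \<otimes> x \<otimes> inv g = x \<longleftrightarrow> g \<otimes> x = x \<otimes> g"
  using assms by (metis inv_solve_right m_closed)

text \<open>Put through a vanishing power instead of \<open>ord\<close>, which suits powers and
  commuting products; for prime \<open>p\<close> the two agree by
  \<open>p_element_iff_ord\<close>.\<close>

definition p_element :: "nat \<Rightarrow> 'a \<Rightarrow> bool" where
  "p_element p x \<longleftrightarrow> x \<in> carrier G \<and> (\<exists>n. x [^] (p ^ n) = \<one>)"

lemma p_element_carrier: "p_element p x \<Longrightarrow> x \<in> carrier G"
  by (simp add: p_element_def)

lemma p_element_iff_ord:
  assumes "Factorial_Ring.prime p" "x \<in> carrier G"
  shows "p_element p x \<longleftrightarrow> (\<exists>n. ord x = p ^ n)"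
  using assms by (metis p_element_def divides_primepow_nat pow_eq_id dvd_refl)

lemma p_element_mult:
  assumes "p_element p x" "p_element p y" "x \<otimes> y = y \<otimes> x"
  shows "p_element p (x \<otimes> y)"
proof -
  obtain m n where mn: "x [^] (p ^ m) = \<one>" "y [^] (p ^ n) = \<one>"
    using assms by (auto simp: p_element_def)
  have c: "x \<in> carrier G" "y \<in> carrier G" using assms by (auto simp: p_element_def)
  have "x [^] (p ^ m * p ^ n) = \<one>" "y [^] (p ^ n * p ^ m) = \<one>"
    using mn c by (simp_all flip: nat_pow_pow)
  then have "(x \<otimes> y) [^] (p ^ (m + n)) = \<one>"
    using pow_mult_distrib[OF assms(3) c] by (simp add: power_add mult.commute)
  then show ?thesis unfolding p_element_def using c by blast
qed

lemma p_element_int_pow: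
  assumes "p_element p x"
  shows "p_element p (x [^] (k::int))"
proof -
  obtain m where m: "x [^] (p ^ m) = \<one>" using assms by (auto simp: p_element_def)
  have c: "x \<in> carrier G" using assms by (rule p_element_carrier)
  have "(x [^] k) [^] int (p ^ m) = (x [^] int (p ^ m)) [^] k"
    using c by (simp only: int_pow_pow mult.commute)
  also have "\<dots> = \<one>" unfolding int_pow_int m by simp
  finally have "(x [^] k) [^] (p ^ m) = \<one>" unfolding int_pow_int .
  then show ?thesis unfolding p_element_def using c by blast
qed

text \<open>Modulo \<open>ord u\<close> the number \<open>k ^ (p ^ e)\<close> is 1 by the order of
  \<open>g\<close> and \<open>k\<close> by Fermat, so the exponent \<open>k\<close> of the action is
  1.\<close>

lemma p_element_commutes_prime_order:
  assumes p: "Factorial_Ring.prime p" and g: "p_element p g"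
    and u: "cyclic_normal u" "u [^] p = \<one>"
  shows "g \<otimes> u = u \<otimes> g"
proof -
  have c: "g \<in> carrier G" "u \<in> carrier G" using g u by (auto simp: p_element_def cyclic_normal_def)
  obtain e where e: "g [^] (p ^ e) = \<one>" using g by (auto simp: p_element_def)
  obtain k where k: "g \<otimes> u \<otimes> inv g = u [^] (k::int)"
    using u c unfolding cyclic_normal_def by blast
  have ord: "ord u dvd p" using u(2) c by (simp flip: pow_eq_id)
  have "int (ord u) dvd k ^ (p ^ e) - 1" using c k e by (intro conj_exponent_power)
  moreover have "int (ord u) dvd k ^ (p ^ e) - k"
    using fermat_theorem_int_power[OF p, of k e] ord
    by (metis cong_iff_dvd_diff dvd_trans of_nat_dvd_iff)
  ultimately have "int (ord u) dvd (k ^ (p ^ e) - 1) - (k ^ (p ^ e) - k)" by (rule dvd_diff)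
  then have "int (ord u) dvd k - 1" by simp
  then have "u [^] (1::int) = u [^] k" using int_pow_eq[OF c(2)] by blast
  then show ?thesis using k c by (simp flip: conj_eq_iff_commutes)
qed

text \<open>Each commutator with \<open>g\<close> moves one term down the central series, so its
  length serves for all \<open>u\<close> and \<open>g\<close>.\<close>

lemma nilpotent_imp_engel:
  assumes "nilpotent_group G"
  obtains n where "\<And>u g. u \<in> carrier G \<Longrightarrow> g \<in> carrier G \<Longrightarrow> ((\<lambda>u. commutator u g) ^^ n) u = \<one>"
proof -
  obtain n K where K: "K 0 = {\<one>}" "K n = carrier G" "\<forall>i\<le>n. K i \<lhd> G"
    and "\<forall>i<n. K i \<subseteq> K (Suc i) \<and> (\<lambda>x. K i #> x) ` K (Suc i) \<subseteq> group_center (G Mod K i)"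
    using assms unfolding nilpotent_group_def by (elim exE conjE) (rule that)
  then have central: "(\<lambda>x. K i #> x) ` K (Suc i) \<subseteq> group_center (G Mod K i)" if "i < n" for i
    using that by blast
  have step: "commutator u g \<in> K i" if i: "i < n" and u: "u \<in> K (Suc i)" and g: "g \<in> carrier G" for i u g
  proof (rule commutator_mem_of_coset_commute)
    show "K i \<lhd> G" using K(3) i by simp
    have "K (Suc i) \<lhd> G" using K(3) i by simp
    then show "u \<in> carrier G" using subgroup.mem_carrier[OF normal_imp_subgroup] u by metis
    have "K i #> u \<in> group_center (G Mod K i)" using central[OF i] u by blast
    moreover have "K i #> g \<in> carrier (G Mod K i)" using g by (auto simp: carrier_FactGroup)
    ultimately show "(K i #> u) <#> (K i #> g) = (K i #> g) <#> (K i #> u)"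
      by (simp add: group_center_def)
  qed fact
  have "((\<lambda>u. commutator u g) ^^ i) u \<in> K (n - i)"
    if "i \<le> n" "u \<in> carrier G" "g \<in> carrier G" for i u g
    using that
  proof (induction i)
    case (Suc i)
    then have "Suc (n - Suc i) = n - i" by simp
    then show ?case using step[of "n - Suc i"] Suc by simp
  qed (simp add: K)
  from this[of n] show ?thesis using K(1) by (intro that[of n]) simp
qed

text \<open>In the nilpotent group generated by \<open>g\<close> and \<open>x\<close> the Engel
  condition says that \<open>ord x\<close> divides a power of \<open>k - 1\<close>, where
  \<open>k\<close> is the exponent of the action. As \<open>k ^ a\<close> is 1 modulo
  \<open>ord x\<close> and \<open>a\<close> is prime to \<open>ord x\<close>,
  \<open>dvd_diff_one_of_dvd_power\<close> makes the action trivial.\<close>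

lemma locally_nilpotent_commutes_coprime:
  assumes nil: "locally_nilpotent_group G"
    and g: "g \<in> carrier G" "g [^] (a::nat) = \<one>"
    and x: "cyclic_normal x" "x [^] (n::nat) = \<one>"
    and cop: "coprime a n"
  shows "g \<otimes> x = x \<otimes> g"
proof -
  have xc: "x \<in> carrier G" using x by (simp add: cyclic_normal_def)
  define H where "H = subgroup_generated G {g, x}"
  interpret H: group H unfolding H_def by (rule group_subgroup_generated)
  have "nilpotent_group H" unfolding H_def
    using nil g xc unfolding locally_nilpotent_group_def by simp
  then obtain m where m: "\<And>u g. u \<in> carrier H \<Longrightarrow> g \<in> carrier H \<Longrightarrow>
      ((\<lambda>u. H.commutator u g) ^^ m) u = \<one>\<^bsub>H\<^esub>"
    using H.nilpotent_imp_engel by metis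
  have gH: "g \<in> carrier H" and xH: "x \<in> carrier H"
    using g xc by (auto simp: H_def carrier_subgroup_generated intro: generate.incl)
  have HG: "H.commutator u g = commutator u g" if "u \<in> carrier H" for u
    using that gH unfolding H.commutator_def commutator_def by (simp add: H_def)
  have "((\<lambda>u. commutator u g) ^^ i) x = ((\<lambda>u. H.commutator u g) ^^ i) x \<and>
      ((\<lambda>u. H.commutator u g) ^^ i) x \<in> carrier H" for i
    by (induction i) (simp_all add: xH gH flip: HG)
  then have engel: "((\<lambda>u. commutator u g) ^^ m) x = \<one>" using m[OF xH gH] by (simp add: H_def)
  obtain k where k: "g \<otimes> x \<otimes> inv g = x [^] (k::int)"
    using x g unfolding cyclic_normal_def by blast
  have comm_pow: "commutator (x [^] l) g = x [^] (l * (1 - k))" for l :: int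
  proof -
    have "g \<otimes> x [^] l \<otimes> inv g = (x [^] l) [^] k"
      using g xc by (simp add: k int_pow_pow mult.commute flip: conj_int_pow)
    then show ?thesis using commutator_eq_int_pow[of g "x [^] l" k] g xc by (simp add: int_pow_pow)
  qed
  have "((\<lambda>u. commutator u g) ^^ i) x = x [^] ((1 - k) ^ i)" for i
    using xc by (induction i) (simp_all add: comm_pow mult.commute)
  then have "int (ord x) dvd (1 - k) ^ m" using engel xc by (simp add: int_pow_eq_id)
  moreover have "(1 - k) ^ m = (- 1) ^ m * (k - 1) ^ m"
    by (simp flip: power_mult_distrib)
  ultimately have "int (ord x) dvd (k - 1) ^ m" by (cases "even m") simp_all
  moreover have "int (ord x) dvd k ^ a - 1" using g xc k by (intro conj_exponent_power)
  moreover have "coprime (int (ord x)) (int a)"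
    using x(2) xc cop by (metis coprime_commute coprime_divisors coprime_int_iff dvd_refl pow_eq_id)
  ultimately have "int (ord x) dvd k - 1" using dvd_diff_one_of_dvd_power by blast
  then have "x [^] (1::int) = x [^] k" using int_pow_eq[OF xc] by blast
  then show ?thesis using k g xc by (simp flip: conj_eq_iff_commutes)
qed

end

section \<open>Elements of prime power order acting on the Baer radical\<close>

locale periodic_baer_radical = abelian_subnormals_normal G for G (structure) +
  assumes hyperabelian: "hyperabelian G"
    and periodic: "b \<in> baer_radical G \<Longrightarrow> \<exists>n::nat. n > 0 \<and> b [^] n = \<one>"
    and locally_nilpotent: "locally_nilpotent_group G"
begin

lemma baer_radical_conj:
  assumes "b \<in> B" "g \<in> carrier G"
  obtains k where "g \<otimes> b \<otimes> inv g = b [^] (k::int)"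
  using baer_radical_cyclic_normal[OF assms(1)] assms(2) unfolding cyclic_normal_def by blast

lemma commutator_in_baer_radical:
  "g \<in> carrier G \<Longrightarrow> h \<in> carrier G \<Longrightarrow> commutator g h \<in> B"
  using hyperabelian commutator_centralizes_baer_radical
  by (intro centralizer_le_baer_radical) auto

lemma baer_radical_order_split:
  fixes p :: nat
  assumes "Factorial_Ring.prime p" "b \<in> B"
  obtains a r where "b [^] (p ^ a * r) = \<one>" "coprime p r"
proof -
  obtain n :: nat where n: "n > 0" "b [^] n = \<one>" using periodic assms(2) by blast
  have "\<not> is_unit p" using assms(1) not_prime_unit by blast
  then obtain r where "n = p ^ multiplicity p n * r" "\<not> p dvd r"
    using n(1) multiplicity_decompose'[of n p] by auto
  then show ?thesis using that n(2) assms(1) prime_imp_coprime by metis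
qed

lemma p_element_commutes_coprime:
  assumes p: "Factorial_Ring.prime p" and g: "p_element p g"
    and b: "b \<in> B" "b [^] (r::nat) = \<one>" "coprime p r"
  shows "g \<otimes> b = b \<otimes> g"
proof -
  obtain e where "g [^] (p ^ e) = \<one>" using g by (auto simp: p_element_def)
  then show ?thesis
    using locally_nilpotent_commutes_coprime[OF locally_nilpotent] p_element_carrier[OF g]
      baer_radical_cyclic_normal[OF b(1)] b(2,3) by (metis coprime_power_left_iff)
qed

text \<open>Elements of \<open>B\<close> of order prime to \<open>p\<close> are centralized by
  \<open>g\<close> anyway, so \<open>g\<close> centralizes all of \<open>B\<close>, and the
  centralizer of \<open>B\<close> lies in \<open>B\<close>.\<close>

lemma p_element_in_baer_radical:
  assumes p: "Factorial_Ring.prime p" and g: "p_element p g"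
    and comm: "\<And>x. x \<in> B \<Longrightarrow> p_element p x \<Longrightarrow> g \<otimes> x = x \<otimes> g"
  shows "g \<in> B"
proof (rule centralizer_le_baer_radical[OF hyperabelian p_element_carrier[OF g]])
  fix x assume x: "x \<in> B"
  have c: "x \<in> carrier G" "g \<in> carrier G" using x p_element_carrier[OF g] by auto
  obtain a r where ar: "x [^] (p ^ a * r) = \<one>" "coprime p r"
    using baer_radical_order_split[OF p x] by blast
  have xB: "x [^] (n::nat) \<in> B" for n
    using baer_radical_subgroup x by (rule subgroup_mem_nat_pow)
  have "(x [^] r) [^] (p ^ a) = \<one>" using ar c by (simp add: nat_pow_pow mult.commute)
  then have 1: "x [^] r \<otimes> g = g \<otimes> x [^] r" using comm[OF xB, of r] c unfolding p_element_def by (metis nat_pow_closed)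
  have "(x [^] (p ^ a)) [^] r = \<one>" using ar c by (simp add: nat_pow_pow)
  then have 2: "x [^] (p ^ a) \<otimes> g = g \<otimes> x [^] (p ^ a)"
    using p_element_commutes_coprime[OF p g xB] ar(2) by metis
  have "coprime (int r) (int (p ^ a))" using ar(2) by (simp add: coprime_commute)
  \<comment> \<open>Bezout splits \<open>x\<close> into its \<open>p\<close>-part, a power of
    \<open>x [^] r\<close>, and a power of \<open>x [^] (p ^ a)\<close>, whose order is prime to
    \<open>p\<close>.\<close>
  then obtain u v where uv: "u * int r + v * int (p ^ a) = 1"
    using bezout_int[of "int r" "int (p ^ a)"] by auto
  have "x = x [^] (int r * u + int (p ^ a) * v)" using uv c by (simp add: mult.commute)
  also have "\<dots> = (x [^] r) [^] u \<otimes> (x [^] (p ^ a)) [^] v"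
    using c by (simp only: int_pow_mult flip: int_pow_pow int_pow_int)
  finally have x_eq: "x = (x [^] r) [^] u \<otimes> (x [^] (p ^ a)) [^] v" .
  have "(x [^] r) [^] u \<otimes> (x [^] (p ^ a)) [^] v \<otimes> g = g \<otimes> ((x [^] r) [^] u \<otimes> (x [^] (p ^ a)) [^] v)"
    using 1 2 c by (intro commutes_mult commutes_int_pow) auto
  then show "g \<otimes> x = x \<otimes> g" using x_eq by simp
qed

text \<open>Writing \<open>Z i\<close> for the elements \<open>z\<close> of the centre of \<open>B\<close> whose power with exponent
  \<open>p ^ i\<close> centralizes \<open>g\<close>, the subgroups generated by \<open>g\<close> and \<open>Z i\<close> are the terms of a subnormal
  series: the last one contains the centre of \<open>B\<close>, hence the derived subgroup of the group.\<close>
lemma p_element_in_baer_radical_of_bounded: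
  assumes p: "Factorial_Ring.prime p" and g: "p_element p g"
    and bounded: "\<And>x. x \<in> B \<Longrightarrow> p_element p x \<Longrightarrow> x [^] (p ^ m) = \<one>"
  shows "g \<in> B"
proof -
  have gc: "g \<in> carrier G" using g by (rule p_element_carrier)
  define Z where "Z i = {z \<in> B. (\<forall>b\<in>B. z \<otimes> b = b \<otimes> z) \<and> z [^] (p ^ i) \<otimes> g = g \<otimes> z [^] (p ^ i)}"
    for i :: nat
  have ZB: "z \<in> B" if "z \<in> Z i" for z i using that by (simp add: Z_def)
  have Zc: "z \<in> carrier G" if "z \<in> Z i" for z i using ZB[OF that] by simp
  have Zpow: "z [^] (k::int) \<in> Z i" if z: "z \<in> Z i" for z i k
  proof -
    have zc: "z \<in> carrier G" using z by (rule Zc)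
    have "z [^] k \<in> B" using baer_radical_subgroup ZB[OF z] by (rule subgroup_int_pow_closed)
    moreover have "z [^] k \<otimes> b = b \<otimes> z [^] k" if "b \<in> B" for b
      using z that zc by (intro commutes_int_pow) (auto simp: Z_def)
    moreover have "(z [^] k) [^] (p ^ i) = (z [^] (p ^ i)) [^] k"
      using zc by (simp add: int_pow_pow mult.commute flip: int_pow_int)
    moreover have "(z [^] (p ^ i)) [^] k \<otimes> g = g \<otimes> (z [^] (p ^ i)) [^] k"
      using z zc gc by (intro commutes_int_pow) (auto simp: Z_def)
    ultimately show ?thesis by (simp add: Z_def)
  qed
  have Zinv: "inv z \<in> Z i" if z: "z \<in> Z i" for z i
    using Zpow[OF z, of "-1"] Zc[OF z] by (simp add: int_pow_neg)
  have Zconj: "h \<otimes> z \<otimes> inv h \<in> Z i" if z: "z \<in> Z i" and h: "h \<in> carrier G" for h z i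
    using baer_radical_conj[OF ZB[OF z] h] Zpow[OF z] by metis
  have Zcomm: "commutator z g \<in> Z i" if z: "z \<in> Z (Suc i)" for z i
  proof -
    have zc: "z \<in> carrier G" using z by (rule Zc)
    obtain k where k: "g \<otimes> z \<otimes> inv g = z [^] (k::int)"
      using baer_radical_conj[OF ZB[OF z] gc] by blast
    have eq: "commutator z g = z [^] (1 - k)"
      using gc zc k by (rule commutator_eq_int_pow)
    \<comment> \<open>Since \<open>g\<close> centralizes \<open>y [^] p\<close>, the element
      \<open>y [^] (1 - k)\<close> is killed by \<open>p\<close>, and a \<open>p\<close>-element
      commutes with it. It is the power of \<open>commutator z g\<close> with exponent
      \<open>p ^ i\<close>.\<close>
    define y where "y = z [^] (p ^ i)"
    have yc: "y \<in> carrier G" using zc by (simp add: y_def)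
    have "g \<otimes> y [^] p \<otimes> inv g = (g \<otimes> y \<otimes> inv g) [^] p" using gc yc by (simp add: conj_nat_pow)
    also have "g \<otimes> y \<otimes> inv g = y [^] k"
      using conj_nat_pow[OF gc zc, of "p ^ i"] zc
      by (simp add: y_def k int_pow_pow mult.commute flip: int_pow_int)
    also have "(y [^] k) [^] p = y [^] (int p * k)"
      using yc by (simp add: int_pow_pow mult.commute flip: int_pow_int)
    finally have "g \<otimes> y [^] p \<otimes> inv g = y [^] (int p * k)" .
    moreover have "y [^] p \<otimes> g = g \<otimes> y [^] p"
      using z zc by (simp add: Z_def y_def nat_pow_pow mult.commute)
    then have "g \<otimes> y [^] p \<otimes> inv g = y [^] int p"
      using gc yc by (simp add: conj_eq_iff_commutes int_pow_int)
    ultimately have "y [^] (int p - int p * k) = \<one>" using yc by (simp add: int_pow_diff)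
    then have "(y [^] (1 - k)) [^] p = \<one>"
      using yc by (simp add: int_pow_pow algebra_simps flip: int_pow_int)
    moreover have "y [^] (1 - k) \<in> B"
      unfolding y_def using baer_radical_subgroup ZB[OF z]
      by (intro subgroup_int_pow_closed subgroup_mem_nat_pow)
    ultimately have "g \<otimes> y [^] (1 - k) = y [^] (1 - k) \<otimes> g"
      using p_element_commutes_prime_order[OF p g] baer_radical_cyclic_normal by blast
    moreover have "y [^] (1 - k) = (z [^] (1 - k)) [^] (p ^ i)"
      unfolding y_def using zc by (simp add: int_pow_pow mult.commute flip: int_pow_int)
    moreover have "z [^] (1 - k) \<in> Z (Suc i)" using z by (rule Zpow)
    ultimately show ?thesis by (simp add: eq Z_def)
  qed
  have chain: "subnormal_subgroup (generate G (insert g (Z i))) G \<Longrightarrow>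
      subnormal_subgroup (generate G {g}) G" for i
  proof (induction i)
    case 0
    \<comment> \<open>As \<open>p ^ 0 = 1\<close>, the elements of \<open>Z 0\<close> commute with
      \<open>g\<close> itself.\<close>
    have comm: "t \<otimes> g = g \<otimes> t" if "t \<in> insert g (Z 0)" for t
      using that by (auto simp: Z_def)
    show ?case
    proof (rule subnormal_generate_step[OF _ _ _ _ 0])
      fix t s assume t: "t \<in> insert g (Z 0)" and s: "s \<in> {g}"
      have tc: "t \<in> carrier G" using t gc Zc by auto
      show "t \<otimes> s \<otimes> inv t \<in> generate G {g}"
        using conj_eq_iff_commutes[OF tc gc] comm[OF t] s by (simp add: generate.incl)
      show "inv t \<otimes> s \<otimes> t \<in> generate G {g}"
        using conj_eq_iff_commutes[OF inv_closed[OF tc] gc] commutes_inv[OF comm[OF t]] s tc gc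
        by (simp add: generate.incl)
    qed (use gc Zc in auto)
  next
    case (Suc i)
    let ?H = "generate G (insert g (Z i))"
    have gH: "g \<in> ?H" "inv g \<in> ?H" by (auto intro: generate.incl generate.inv)
    have ZH: "z \<in> ?H" if "z \<in> Z i" for z using that by (auto intro: generate.incl)
    \<comment> \<open>Conjugation by \<open>t\<close> multiplies \<open>g\<close> by a commutator,
      which drops from \<open>Z (Suc i)\<close> to \<open>Z i\<close>, and it sends elements of
      \<open>Z i\<close> to powers of themselves.\<close>
    have key: "t \<otimes> s \<otimes> inv t \<in> ?H" if t: "t \<in> Z (Suc i)" and s: "s \<in> insert g (Z i)" for t s
    proof -
      have c: "t \<in> carrier G" "s \<in> carrier G" using t s gc Zc by auto
      have "t \<otimes> g \<otimes> inv t = commutator t g \<otimes> g"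
        using c gc by (simp add: commutator_def word_simps)
      then have "t \<otimes> g \<otimes> inv t \<in> ?H" using ZH[OF Zcomm[OF t]] gH generate.eng by simp
      moreover have "t \<otimes> s \<otimes> inv t \<in> ?H" if "s \<in> Z i"
        using Zconj[OF that c(1)] by (rule ZH)
      ultimately show ?thesis using s by auto
    qed
    have keyg: "h \<otimes> s \<otimes> inv h \<in> ?H" if "h = g \<or> h = inv g" and s: "s \<in> insert g (Z i)" for h s
    proof -
      have "h \<otimes> g \<otimes> inv h = g" and hc: "h \<in> carrier G" using that gc by (auto simp: word_simps)
      then show ?thesis using s gH ZH Zconj by auto
    qed
    have "subnormal_subgroup ?H G"
    proof (rule subnormal_generate_step[OF _ _ _ _ Suc.prems])
      have "z \<in> Z (Suc i)" if "z \<in> Z i" for z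
      proof -
        have "z [^] (p ^ Suc i) = (z [^] (p ^ i)) [^] p"
          using Zc[OF that] by (simp add: nat_pow_pow mult.commute)
        then show ?thesis
          using that Zc[OF that] gc commutes_nat_pow[of "z [^] (p ^ i)" g p] by (simp add: Z_def)
      qed
      then show "insert g (Z i) \<subseteq> insert g (Z (Suc i))" by blast
      fix t s assume t: "t \<in> insert g (Z (Suc i))" and s: "s \<in> insert g (Z i)"
      show "t \<otimes> s \<otimes> inv t \<in> ?H" using t key[OF _ s] keyg[OF _ s] by auto
      show "inv t \<otimes> s \<otimes> t \<in> ?H"
        using t key[OF Zinv s, of t] keyg[of "inv g", OF _ s] gc Zc[of t "Suc i"] by auto
    qed (use gc Zc in auto)
    then show ?case by (rule Suc.IH)
  qed
  \<comment> \<open>The bound enters here: the \<open>p\<close>-part of \<open>z\<close> is killed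
    by \<open>p ^ m\<close>, so \<open>z [^] (p ^ m)\<close> has order prime to \<open>p\<close> and
    \<open>g\<close> centralizes it.\<close>
  have centre: "z \<in> Z m" if z: "z \<in> B" "\<And>b. b \<in> B \<Longrightarrow> z \<otimes> b = b \<otimes> z" for z
  proof -
    have zc: "z \<in> carrier G" using z by simp
    obtain a r where ar: "z [^] (p ^ a * r) = \<one>" "coprime p r"
      using baer_radical_order_split[OF p z(1)] by blast
    have zB: "z [^] (n::nat) \<in> B" for n
      using baer_radical_subgroup z(1) by (rule subgroup_mem_nat_pow)
    have "(z [^] r) [^] (p ^ a) = \<one>" using ar zc by (simp add: nat_pow_pow mult.commute)
    then have "(z [^] r) [^] (p ^ m) = \<one>" using bounded[OF zB, of r] zc by (auto simp: p_element_def)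
    then have "(z [^] (p ^ m)) [^] r = \<one>" using zc by (simp add: nat_pow_pow mult.commute)
    then have "g \<otimes> z [^] (p ^ m) = z [^] (p ^ m) \<otimes> g"
      using p_element_commutes_coprime[OF p g zB] ar(2) by blast
    then show ?thesis using z unfolding Z_def by simp
  qed
  let ?M = "generate G (insert g (Z m))"
  have sub: "insert g (Z m) \<subseteq> carrier G" using gc Zc by auto
  have sM: "subgroup ?M G" using sub by (rule generate_is_subgroup)
  have "?M \<lhd> G"
  proof (rule normal_invI[OF sM])
    fix u v assume uv: "u \<in> carrier G" "v \<in> ?M"
    show "u \<otimes> v \<otimes> inv u \<in> ?M"
    proof (rule conj_closed_of_commutator_closed[OF subgroup_self sM _ _ uv])
      show "?M \<subseteq> carrier G" using sM by (rule subgroup.subset)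
      fix x y assume "x \<in> carrier G" "y \<in> ?M"
      then have "commutator x y \<in> Z m"
        using subgroup.mem_carrier[OF sM]
        by (intro centre commutator_in_baer_radical commutator_centralizes_baer_radical) auto
      then show "commutator x y \<in> ?M" by (auto intro: generate.incl)
    qed
  qed
  then have "subnormal_subgroup (generate G {g}) G" by (intro chain[of m] subnormal_normal)
  then show ?thesis using subnormal_cyclic gc by blast
qed

end

section \<open>Power maps on elements of prime power order, and powers of products in class
  two\<close>

context group
begin

lemma p_element_ord:
  assumes "Factorial_Ring.prime p" "p_element p x"
  obtains s where "ord x = p ^ s"
  using assms p_element_iff_ord p_element_carrier by blast

text \<open>If \<open>x\<close> and \<open>w\<close> commute, then \<open>x \<otimes> w [^] n\<close> has smaller order than \<open>x\<close>.\<close>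
lemma cancelling_power:
  assumes p: "Factorial_Ring.prime p" and c: "x \<in> carrier G" "w \<in> carrier G"
    and ord: "ord x = p ^ s" "ord w = p ^ t" "s \<le> t"
    and meet: "x [^] (l::int) = w [^] (i::int)" "x [^] l \<noteq> \<one>"
  obtains n r where "r < s" "x [^] (p ^ r) \<otimes> (w [^] (n::int)) [^] (p ^ r) = \<one>"
proof -
  \<comment> \<open>With \<open>p ^ r\<close> this gcd, \<open>x [^] l\<close> and
    \<open>x [^] (p ^ r)\<close> generate the same subgroup; it is nontrivial, so
    \<open>r < s\<close>.\<close>
  define d where "d = nat (gcd l (int (p ^ s)))"
  have d: "int d = gcd l (int (p ^ s))" by (simp add: d_def)
  then have "int d dvd int (p ^ s)" by simp
  then have "d dvd p ^ s" by (simp only: of_nat_dvd_iff)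
  then obtain r where r: "r \<le> s" "d = p ^ r" using divides_primepow_nat[OF p] by blast
  have "r \<noteq> s"
  proof
    assume "r = s"
    then have "int (ord x) dvd l" using d r ord by (metis gcd_dvd1)
    then show False using meet(2) int_pow_eq_id[OF c(1)] by blast
  qed
  then have rs: "r < s" using r by simp
  obtain u v where "u * l + v * int (p ^ s) = int d" unfolding d using bezout_int by blast
  then have uv: "int (p ^ r) = l * u + int (ord x) * v" by (simp add: r(2) ord mult.commute)
  define e where "e = i * u"
  have "x [^] (int (ord x) * v) = \<one>" using c by (simp add: int_pow_eq_id)
  then have "x [^] int (p ^ r) = (x [^] l) [^] u"
    unfolding uv using c by (simp add: int_pow_mult int_pow_pow)
  then have xe: "x [^] int (p ^ r) = w [^] e" using c by (simp add: meet(1) e_def int_pow_pow)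
  have pow: "p ^ r * p ^ (s - r) = p ^ s" using rs by (simp flip: power_add)
  \<comment> \<open>Raising \<open>x [^] (p ^ r) = w [^] e\<close> to the power
    \<open>p ^ (s - r)\<close> gives 1, so \<open>p ^ t\<close> divides
    \<open>e * p ^ (s - r)\<close>. As \<open>s \<le> t\<close>, the number \<open>e\<close> is a
    multiple of \<open>p ^ r\<close>, and a root of \<open>w [^] e\<close> with exponent
    \<open>p ^ r\<close> can be inverted to cancel \<open>x\<close>.\<close>
  have "w [^] (e * int (p ^ (s - r))) = (x [^] int (p ^ r)) [^] int (p ^ (s - r))"
    unfolding xe int_pow_pow[OF c(2)] ..
  also have "\<dots> = x [^] int (p ^ s)" using c pow by (simp add: int_pow_pow flip: of_nat_mult of_nat_power)
  also have "\<dots> = \<one>" using c ord by (simp add: int_pow_eq_id)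
  finally have "int (p ^ t) dvd e * int (p ^ (s - r))" using c ord(2) by (simp add: int_pow_eq_id)
  moreover have "p ^ t = p ^ (t - s) * p ^ r * p ^ (s - r)"
    using rs ord(3) by (simp flip: power_add)
  ultimately have "int (p ^ (t - s) * p ^ r) * int (p ^ (s - r)) dvd e * int (p ^ (s - r))"
    by (simp only: of_nat_mult)
  then have "int (p ^ (t - s) * p ^ r) dvd e" using prime_gt_0_nat[OF p] by simp
  then obtain e' where e': "e = int (p ^ r) * e'" by (metis dvdE dvd_mult_right of_nat_mult)
  have "x [^] int (p ^ r) \<otimes> (w [^] (- e')) [^] int (p ^ r) = w [^] (e + (- e') * int (p ^ r))"
    unfolding xe int_pow_pow[OF c(2)] int_pow_mult[OF c(2)] ..
  also have "e + (- e') * int (p ^ r) = 0" by (simp add: e')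
  finally have "x [^] int (p ^ r) \<otimes> (w [^] (- e')) [^] int (p ^ r) = \<one>" by simp
  then show ?thesis using that rs by (simp only: int_pow_int)
qed

lemma ord_le_mult_ord_pow:
  assumes "x \<in> carrier G" "ord (x [^] (n::nat)) > 0" "n > 0"
  shows "ord x \<le> n * ord (x [^] n)"
proof -
  have "x [^] (n * ord (x [^] n)) = \<one>" using assms(1) by (simp flip: nat_pow_pow)
  then have "ord x dvd n * ord (x [^] n)" using assms(1) by (simp add: pow_eq_id)
  then show ?thesis using assms(2,3) by (metis dvd_imp_le nat_0_less_mult_iff)
qed

lemma p_element_ord_gt_0:
  "Factorial_Ring.prime p \<Longrightarrow> p_element p x \<Longrightarrow> ord x > 0"
  by (metis p_element_ord prime_gt_0_nat zero_less_power)

text \<open>Take \<open>x\<close> of minimal order outside the kernel and \<open>w\<close> in the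
  kernel of order at least that of \<open>x\<close>. The two cyclic groups meet trivially, since otherwise
  \<open>x\<close> could be replaced by some \<open>x \<otimes> w [^] n\<close> of smaller order; now
  \<open>\<phi> x = \<phi> (x \<otimes> w)\<close> is a power both of \<open>x\<close> and of \<open>x \<otimes> w\<close>.\<close>
lemma power_map_trivial:
  assumes p: "Factorial_Ring.prime p"
    and A: "\<And>x. x \<in> A \<Longrightarrow> p_element p x"
    and A_pow: "\<And>x k. x \<in> A \<Longrightarrow> x [^] (k::int) \<in> A"
    and A_mult: "\<And>x y. x \<in> A \<Longrightarrow> y \<in> A \<Longrightarrow> x \<otimes> y = y \<otimes> x \<Longrightarrow> x \<otimes> y \<in> A"
    and phi_pow: "\<And>x. x \<in> A \<Longrightarrow> \<exists>k::int. \<phi> x = x [^] k"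
    and phi_mult: "\<And>x y. x \<in> A \<Longrightarrow> y \<in> A \<Longrightarrow> x \<otimes> y = y \<otimes> x \<Longrightarrow> \<phi> (x \<otimes> y) = \<phi> x \<otimes> \<phi> y"
    and kernel: "\<And>x. x \<in> A \<Longrightarrow> \<exists>w\<in>A. x \<otimes> w = w \<otimes> x \<and> \<phi> w = \<one> \<and> ord x \<le> ord w"
  shows "x \<in> A \<Longrightarrow> \<phi> x = \<one>"
proof (induction "ord x" arbitrary: x rule: less_induct)
  case less
  have Ac: "y \<in> carrier G" if "y \<in> A" for y using A[OF that] by (rule p_element_carrier)
  have x: "x \<in> A" and xc: "x \<in> carrier G" using less.prems Ac by auto
  obtain w where w: "w \<in> A" "x \<otimes> w = w \<otimes> x" "\<phi> w = \<one>" "ord x \<le> ord w" using kernel x by blast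
  have wc: "w \<in> carrier G" using w Ac by auto
  have phi_c: "\<phi> y \<in> carrier G" if "y \<in> A" for y using phi_pow[OF that] Ac[OF that] by auto
  have oneA: "\<one> \<in> A" using A_pow[OF x, of 0] by simp
  have phi_one: "\<phi> \<one> = \<one>" using phi_pow[OF oneA] by auto
  have nat: "\<phi> (w [^] (n::nat)) = \<one>" for n
  proof (induction n)
    case (Suc n)
    have "w [^] n \<in> A" using A_pow[OF w(1), of "int n"] by (simp add: int_pow_int)
    then show ?case using phi_mult[of "w [^] n" w] w wc Suc by (simp add: commutes_nat_pow)
  qed (simp add: phi_one)
  have phi_w: "\<phi> (w [^] (n::int)) = \<one>" for n
  proof (cases n rule: int_cases2)
    case (nonneg m)
    then show ?thesis using nat by (simp add: int_pow_int)
  next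
    case (nonpos m)
    have "w [^] n \<otimes> w [^] m = \<one>" "w [^] m \<otimes> w [^] n = \<one>"
      using wc nonpos by (simp_all add: int_pow_neg_int)
    moreover have "w [^] m \<in> A" using A_pow[OF w(1), of "int m"] by (simp add: int_pow_int)
    ultimately have "\<phi> (w [^] n) \<otimes> \<phi> (w [^] m) = \<one>"
      using phi_mult[OF A_pow[OF w(1), of n], of "w [^] m"] phi_one by simp
    then show ?thesis using nat phi_c[OF A_pow[OF w(1)]] by simp
  qed
  obtain s t where st: "ord x = p ^ s" "ord w = p ^ t" using p_element_ord[OF p] A x w by metis
  have "s \<le> t" using w(4) st prime_gt_1_nat[OF p] by simp
  obtain i where i: "\<phi> (x \<otimes> w) = (x \<otimes> w) [^] (i::int)" using phi_pow A_mult x w by blast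
  obtain j where j: "\<phi> x = x [^] (j::int)" using phi_pow x by blast
  have "\<phi> (x \<otimes> w) = \<phi> x" using phi_mult[OF x w(1,2)] w(3) phi_c[OF x] by simp
  then have eq: "x [^] j = x [^] i \<otimes> w [^] i"
    using i j int_pow_mult_distrib[OF w(2) xc wc] by simp
  then have "x [^] (j - i) = inv (x [^] i) \<otimes> (x [^] i \<otimes> w [^] i)"
    using int_pow_mult[OF xc, of "- i" j] int_pow_neg[OF xc, of i] eq by simp
  then have meet: "x [^] (j - i) = w [^] i" using xc wc by (simp add: word_simps)
  show ?case
  proof (cases "w [^] i = \<one>")
    case True
    then have "int (p ^ t) dvd i" using wc st by (simp add: int_pow_eq_id)
    moreover have "int (p ^ s) dvd int (p ^ t)" using \<open>s \<le> t\<close> by (simp add: le_imp_power_dvd)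
    ultimately have "x [^] i = \<one>" using xc st int_pow_eq_id by (metis dvd_trans)
    then show ?thesis using j eq True by simp
  next
    case False
    then obtain n r where nr: "r < s" "x [^] (p ^ r) \<otimes> (w [^] (n::int)) [^] (p ^ r) = \<one>"
      using cancelling_power[OF p xc wc st \<open>s \<le> t\<close> meet] meet by metis
    \<comment> \<open>The map \<open>\<phi>\<close> is trivial on powers of \<open>w\<close>, so
      \<open>x\<close> and \<open>x \<otimes> v\<close> have the same image, and the latter has
      smaller order.\<close>
    define v where "v = w [^] n"
    have v: "v \<in> A" "v \<in> carrier G" "\<phi> v = \<one>"
      using A_pow[OF w(1)] wc phi_w by (auto simp: v_def)
    have xv: "x \<otimes> v = v \<otimes> x" unfolding v_def using commutes_int_pow[OF w(2)[symmetric] wc xc] by simp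
    have "(x \<otimes> v) [^] (p ^ r) = \<one>" using nr(2) pow_mult_distrib[OF xv xc v(2)] by (simp add: v_def)
    then have "ord (x \<otimes> v) dvd p ^ r" using xc v by (simp add: pow_eq_id)
    then have "ord (x \<otimes> v) \<le> p ^ r" using prime_gt_0_nat[OF p] by (intro dvd_imp_le) simp_all
    also have "\<dots> < ord x" using nr(1) st(1) prime_gt_1_nat[OF p] by simp
    finally have "\<phi> (x \<otimes> v) = \<one>" using less.hyps A_mult x v xv by blast
    then show ?thesis using phi_mult[OF x v(1) xv] v(3) phi_c[OF x] by simp
  qed
qed

text \<open>Collection formula with \<open>d\<close> as the commutator: the next \<open>x\<close> is
  moved past \<open>n\<close> factors \<open>v\<close> and leaves \<open>d [^] n\<close>, and these
  exponents add up to the binomial coefficient.\<close>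

lemma class_two_power:
  assumes c: "x \<in> carrier G" "v \<in> carrier G" "d \<in> carrier G"
    and d: "v \<otimes> x = x \<otimes> v \<otimes> d" "d \<otimes> x = x \<otimes> d" "d \<otimes> v = v \<otimes> d"
  shows "(x \<otimes> v) [^] (n::nat) = x [^] n \<otimes> v [^] n \<otimes> d [^] (n choose 2)"
proof (induction n)
  case (Suc n)
  have "inv x \<otimes> v \<otimes> x = v \<otimes> d" using c d(1) by (simp add: m_assoc inv_mult_cancel)
  then have "(v \<otimes> d) [^] n = inv x \<otimes> v [^] n \<otimes> x"
    using conj_nat_pow[of "inv x" v n] c by simp
  then have "inv x \<otimes> v [^] n \<otimes> x = v [^] n \<otimes> d [^] n"
    using pow_mult_distrib[OF d(3)[symmetric] c(2,3), of n] by simp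
  then have "x \<otimes> (inv x \<otimes> v [^] n \<otimes> x) = x \<otimes> (v [^] n \<otimes> d [^] n)" by simp
  then have vx: "v [^] n \<otimes> x = x \<otimes> v [^] n \<otimes> d [^] n" using c by (simp add: word_simps)
  have dv: "d [^] m \<otimes> v = v \<otimes> d [^] m" and dx: "d [^] m \<otimes> x = x \<otimes> d [^] m" for m :: nat
    using c d by (auto intro: commutes_nat_pow)
  have "(x \<otimes> v) [^] Suc n = x [^] n \<otimes> v [^] n \<otimes> d [^] (n choose 2) \<otimes> (x \<otimes> v)"
    by (simp add: Suc)
  also have "\<dots> = x [^] n \<otimes> v [^] n \<otimes> (d [^] (n choose 2) \<otimes> x) \<otimes> v" using c by (simp add: m_assoc)
  also have "\<dots> = x [^] n \<otimes> (v [^] n \<otimes> x) \<otimes> (d [^] (n choose 2) \<otimes> v)"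
    unfolding dx using c by (simp add: m_assoc)
  also have "\<dots> = x [^] n \<otimes> x \<otimes> v [^] n \<otimes> (d [^] n \<otimes> v) \<otimes> d [^] (n choose 2)"
    unfolding vx dv[of "n choose 2"] using c by (simp add: m_assoc)
  also have "\<dots> = x [^] Suc n \<otimes> v [^] Suc n \<otimes> (d [^] n \<otimes> d [^] (n choose 2))"
    unfolding dv using c by (simp add: m_assoc)
  also have "d [^] n \<otimes> d [^] (n choose 2) = d [^] (Suc n choose 2)"
    using c by (simp add: nat_pow_mult numeral_2_eq_2)
  finally show ?case .
qed (use c in \<open>simp add: numeral_2_eq_2\<close>)

end

section \<open>Commutation of the p-elements of the Baer radical\<close>

context periodic_baer_radical
begin

lemma baer_radical_mult: "x \<in> B \<Longrightarrow> y \<in> B \<Longrightarrow> x \<otimes> y \<in> B"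
  by (rule subgroup.m_closed[OF baer_radical_subgroup])

lemma baer_radical_int_pow: "x \<in> B \<Longrightarrow> x [^] (k::int) \<in> B"
  by (rule subgroup_int_pow_closed[OF baer_radical_subgroup])

lemma baer_radical_nat_pow: "x \<in> B \<Longrightarrow> x [^] (k::nat) \<in> B"
  by (rule subgroup_mem_nat_pow[OF baer_radical_subgroup])

lemma baer_radical_commutator_pow:
  assumes "b \<in> B" "g \<in> carrier G"
  shows "\<exists>k::int. commutator b g = b [^] k"
  using baer_radical_conj[OF assms] commutator_eq_int_pow[OF assms(2)] assms by (metis baer_radical_carrier)

text \<open>The commutator of \<open>x\<close> and \<open>v\<close> is a power of \<open>x\<close>,
  hence killed by \<open>n\<close>, and it commutes with \<open>v\<close>; so the commutator of
  \<open>x\<close> and \<open>v [^] n\<close> is its \<open>n\<close>-th power.\<close>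

lemma baer_radical_commutes_pow:
  assumes x: "x \<in> B" "x [^] (n::nat) = \<one>" and v: "v \<in> B"
  shows "x \<otimes> v [^] n = v [^] n \<otimes> x"
proof -
  have c: "x \<in> carrier G" "v \<in> carrier G" using x v by auto
  define d where "d = commutator x v"
  have dc: "d \<in> carrier G" using c by (simp add: d_def)
  obtain k where "d = x [^] (k::int)" using baer_radical_commutator_pow[OF x(1) c(2)] d_def by auto
  then have "d [^] n = (x [^] n) [^] k" using c by (simp add: int_pow_pow mult.commute flip: int_pow_int)
  then have dn: "d [^] n = \<one>" using x(2) by simp
  have dv: "d \<otimes> v = v \<otimes> d" unfolding d_def using c v by (simp add: commutator_centralizes_baer_radical)
  have "x \<otimes> v \<otimes> inv x = d \<otimes> v" using c by (simp add: d_def commutator_def word_simps)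
  then have "x \<otimes> v [^] n \<otimes> inv x = v [^] n"
    using conj_nat_pow[OF c, of n] pow_mult_distrib[OF dv dc c(2), of n] c by (simp add: dn)
  then show ?thesis using c by (simp add: conj_eq_iff_commutes)
qed

definition unbounded_primary :: "nat \<Rightarrow> bool" where
  "unbounded_primary p \<longleftrightarrow> (\<forall>n. \<exists>x\<in>B. p_element p x \<and> n < ord x)"

lemma unbounded_primaryI:
  assumes p: "Factorial_Ring.prime p" and "p_element p g" "g \<notin> B"
  shows "unbounded_primary p"
  unfolding unbounded_primary_def
proof
  fix n
  obtain x where x: "x \<in> B" "p_element p x" "x [^] (p ^ n) \<noteq> \<one>"
    using p_element_in_baer_radical_of_bounded[OF p] assms by blast
  obtain j where j: "ord x = p ^ j" using p_element_ord[OF p x(2)] by blast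
  have "n < j"
  proof (rule ccontr)
    assume "\<not> n < j"
    then have "ord x dvd p ^ n" by (simp add: j le_imp_power_dvd)
    then show False using x by (simp add: pow_eq_id)
  qed
  also have "j < ord x" using j prime_gt_1_nat[OF p] by (simp add: power_gt_expt)
  finally show "\<exists>x\<in>B. p_element p x \<and> n < ord x" using x by blast
qed

text \<open>Multiplicativity is asked only for commuting pairs, because the first application is the
  proof that the \<open>p\<close>-elements of \<open>B\<close> commute.\<close>

lemma primary_power_map_trivial:
  assumes p: "Factorial_Ring.prime p"
    and "\<And>x. x \<in> B \<Longrightarrow> p_element p x \<Longrightarrow> \<exists>k::int. \<phi> x = x [^] k"
    and "\<And>x y. x \<in> B \<Longrightarrow> p_element p x \<Longrightarrow> y \<in> B \<Longrightarrow> p_element p y \<Longrightarrow> x \<otimes> y = y \<otimes> x \<Longrightarrow>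
      \<phi> (x \<otimes> y) = \<phi> x \<otimes> \<phi> y"
    and "\<And>x. x \<in> B \<Longrightarrow> p_element p x \<Longrightarrow>
      \<exists>w\<in>B. p_element p w \<and> x \<otimes> w = w \<otimes> x \<and> \<phi> w = \<one> \<and> ord x \<le> ord w"
    and "x \<in> B" "p_element p x"
  shows "\<phi> x = \<one>"
proof (rule power_map_trivial[OF p, where A = "{x \<in> B. p_element p x}" and \<phi> = \<phi>])
  show "x \<in> {x \<in> B. p_element p x}" using assms(5,6) by simp
  fix y assume "y \<in> {x \<in> B. p_element p x}"
  then show "\<exists>w\<in>{x \<in> B. p_element p x}. y \<otimes> w = w \<otimes> y \<and> \<phi> w = \<one> \<and> ord y \<le> ord w"
    using assms(4)[of y] by blast
next
  fix y z assume "y \<in> {x \<in> B. p_element p x}" "z \<in> {x \<in> B. p_element p x}" "y \<otimes> z = z \<otimes> y"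
  then show "\<phi> (y \<otimes> z) = \<phi> y \<otimes> \<phi> z" using assms(3)[of y z] by blast
qed (use assms(2) in \<open>auto simp: baer_radical_int_pow p_element_int_pow baer_radical_mult p_element_mult\<close>)

text \<open>In general the commutator of \<open>y\<close> appears conjugated by \<open>x\<close>;
  here it centralizes \<open>B\<close>, so taking commutators with \<open>g\<close> is an
  endomorphism of \<open>B\<close>.\<close>

lemma commutator_mult_left:
  assumes "x \<in> B" "y \<in> B" "g \<in> carrier G"
  shows "commutator (x \<otimes> y) g = commutator x g \<otimes> commutator y g"
proof -
  have c: "x \<in> carrier G" "y \<in> carrier G" using assms by auto
  have "commutator y g \<otimes> inv x = inv x \<otimes> commutator y g"
    using assms c subgroup.m_inv_closed[OF baer_radical_subgroup]
    by (intro commutator_centralizes_baer_radical) auto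
  moreover have "commutator (x \<otimes> y) g = x \<otimes> (commutator y g \<otimes> inv x) \<otimes> (x \<otimes> g \<otimes> inv x \<otimes> inv g)"
    using assms c by (simp add: commutator_def word_simps)
  ultimately have "commutator (x \<otimes> y) g = commutator y g \<otimes> commutator x g"
    using assms c by (simp add: commutator_def[of x g] word_simps)
  also have "\<dots> = commutator x g \<otimes> commutator y g"
    using assms c by (intro commutator_centralizes_baer_radical commutator_in_baer_radical)
  finally show ?thesis .
qed

lemma primary_commutes_of_unbounded:
  assumes p: "Factorial_Ring.prime p" and unb: "unbounded_primary p"
    and x: "x \<in> B" "p_element p x" and g: "g \<in> B" "p_element p g"
  shows "x \<otimes> g = g \<otimes> x"
proof -
  have gc: "g \<in> carrier G" using g by simp
  have "commutator x g = \<one>"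
  proof (rule primary_power_map_trivial[OF p _ _ _ x])
    fix x assume x: "x \<in> B" "p_element p x"
    have xc: "x \<in> carrier G" using x by simp
    \<comment> \<open>\<open>N\<close> kills \<open>x\<close> and \<open>g\<close>, so the
      \<open>N\<close>-th power of any element of \<open>B\<close> commutes with both. The order of
      \<open>v\<close> is taken so large that \<open>v [^] N\<close> still has larger order than
      \<open>x\<close>.\<close>
    define N where "N = ord x * ord g"
    have N: "N > 0" using p_element_ord_gt_0[OF p] x g by (simp add: N_def)
    obtain v where v: "v \<in> B" "p_element p v" "N * ord x < ord v"
      using unb unfolding unbounded_primary_def by blast
    define w where "w = v [^] N"
    have vc: "v \<in> carrier G" using v by simp
    have w: "w \<in> B" "p_element p w"
      using v baer_radical_nat_pow p_element_int_pow[of p v "int N"] by (auto simp: w_def int_pow_int)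
    have "x [^] N = \<one>" "g [^] N = \<one>" using xc gc by (simp_all add: N_def pow_eq_id)
    then have "x \<otimes> w = w \<otimes> x" "commutator w g = \<one>"
      using baer_radical_commutes_pow x(1) g(1) v(1) w(1) gc
      by (auto simp: w_def commutator_eq_one_iff)
    moreover have "ord v \<le> N * ord w"
      unfolding w_def
      using ord_le_mult_ord_pow[OF vc _ N] p_element_ord_gt_0[OF p w(2)] by (simp add: w_def)
    then have "N * ord x < N * ord w" using v(3) by linarith
    ultimately show "\<exists>w\<in>B. p_element p w \<and> x \<otimes> w = w \<otimes> x \<and> commutator w g = \<one> \<and> ord x \<le> ord w"
      using w by auto
  qed (blast intro: gc baer_radical_commutator_pow commutator_mult_left)+
  then show ?thesis using x gc by (simp add: commutator_eq_one_iff)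
qed

text \<open>For odd \<open>p\<close> a noncentral \<open>x\<close> of minimal order has central power with exponent \<open>p\<close>, which makes
  the correction term in the power of \<open>x \<otimes> y [^] n\<close> vanish.\<close>
lemma primary_commutes_of_odd:
  assumes p: "Factorial_Ring.prime p" and odd: "odd p"
  shows "x \<in> B \<Longrightarrow> p_element p x \<Longrightarrow> y \<in> B \<Longrightarrow> p_element p y \<Longrightarrow> x \<otimes> y = y \<otimes> x"
proof (induction "ord x" arbitrary: x y rule: less_induct)
  case less
  note x = less.prems(1,2) and y = less.prems(3,4)
  have c: "x \<in> carrier G" "y \<in> carrier G" using x y by auto
  show ?case
  proof (rule ccontr)
    assume noncomm: "x \<otimes> y \<noteq> y \<otimes> x"
    then have "ord x \<le> ord y" using less.hyps[OF _ y x] by force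
    obtain s t where st: "ord x = p ^ s" "ord y = p ^ t" using p_element_ord[OF p] x y by metis
    have "s \<le> t" using \<open>ord x \<le> ord y\<close> st prime_gt_1_nat[OF p] by simp
    obtain k where k: "commutator x y = x [^] (k::int)"
      using baer_radical_commutator_pow x c by blast
    obtain l where l: "x \<otimes> y \<otimes> inv x = y [^] (l::int)" using baer_radical_conj y c by blast
    \<comment> \<open>Cyclic subgroups of \<open>B\<close> are normal, so the commutator is a power
      of \<open>y\<close> as well as of \<open>x\<close>; being nontrivial, it lets
      \<open>cancelling_power\<close> apply.\<close>
    have "commutator x y = y [^] (l - 1)"
      unfolding commutator_def l using c by (simp add: int_pow_diff)
    then have meet: "x [^] k = y [^] (l - 1)" by (simp add: k)
    moreover have "x [^] k \<noteq> \<one>" using noncomm c by (simp flip: k add: commutator_eq_one_iff)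
    ultimately obtain n r where nr: "r < s" "x [^] (p ^ r) \<otimes> (y [^] (n::int)) [^] (p ^ r) = \<one>"
      using cancelling_power[OF p c st \<open>s \<le> t\<close>] by metis
    define v where "v = y [^] n"
    have v: "v \<in> B" "p_element p v" "v \<in> carrier G"
      using y baer_radical_int_pow p_element_int_pow c by (auto simp: v_def)
    define d where "d = commutator (inv x) v"
    have dc: "d \<in> carrier G" using c v by (simp add: d_def)
    have dB: "d \<otimes> b = b \<otimes> d" if "b \<in> B" for b
      unfolding d_def using c v that by (intro commutator_centralizes_baer_radical) auto
    have vx: "v \<otimes> x \<otimes> inv v = x \<otimes> d" using c v by (simp add: d_def commutator_def word_simps)
    then have vx': "v \<otimes> x = x \<otimes> v \<otimes> d"
      using c v dc dB[OF v(1)] by (metis inv_solve_right m_assoc m_closed)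
    have "s > 0" using nr(1) by simp
    have "x [^] p \<otimes> v = v \<otimes> x [^] p"
    proof (rule less.hyps)
      have "(x [^] p) [^] (p ^ (s - 1)) = x [^] ord x"
        using c \<open>s > 0\<close> by (simp add: nat_pow_pow st flip: power_Suc)
      then have "ord (x [^] p) dvd p ^ (s - 1)" using c by (simp flip: pow_eq_id)
      then have "ord (x [^] p) \<le> p ^ (s - 1)" using prime_gt_0_nat[OF p] by (intro dvd_imp_le) simp_all
      also have "\<dots> < ord x" using \<open>s > 0\<close> prime_gt_1_nat[OF p] by (simp add: st)
      finally show "ord (x [^] p) < ord x" .
      show "p_element p (x [^] p)" using p_element_int_pow[OF x(2), of "int p"] by (simp add: int_pow_int)
    qed (use x v in \<open>auto intro: baer_radical_nat_pow\<close>)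
    then have "v \<otimes> x [^] p \<otimes> inv v = x [^] p" using c v by (simp add: conj_eq_iff_commutes)
    then have "x [^] p \<otimes> d [^] p = x [^] p"
      using conj_nat_pow[OF v(3) c(1), of p] pow_mult_distrib[OF _ c(1) dc, of p] dB[OF x(1)]
      by (simp add: vx)
    then have dp: "d [^] p = \<one>" using c dc by simp
    \<comment> \<open>Oddness is decisive here: in the quaternion group of order 8 one has
      \<open>r = 1\<close> and the coefficient is 1. For \<open>r = 0\<close> it is 0.\<close>
    have "p dvd p ^ r choose 2"
    proof (cases "r = 0")
      case False
      have "even (p ^ r - 1)" using odd by simp
      then have "p ^ r choose 2 = p ^ r * ((p ^ r - 1) div 2)"
        by (simp add: choose_two div_mult_swap)
      then show ?thesis using False by (simp add: dvd_power)
    qed (simp add: numeral_2_eq_2)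
    then obtain q where "p ^ r choose 2 = p * q" by blast
    then have "d [^] (p ^ r choose 2) = \<one>" using dc dp by (simp flip: nat_pow_pow)
    then have xv: "(x \<otimes> v) [^] (p ^ r) = \<one>"
      using class_two_power[OF c(1) v(3) dc vx' dB[OF x(1)] dB[OF v(1)], of "p ^ r"] nr(2) c v
      by (simp add: v_def)
    have xvB: "x \<otimes> v \<in> B" using x v baer_radical_mult by blast
    have "ord (x \<otimes> v) dvd p ^ r" using xv c v by (simp flip: pow_eq_id)
    then have "ord (x \<otimes> v) \<le> p ^ r" using prime_gt_0_nat[OF p] by (intro dvd_imp_le) simp_all
    also have "\<dots> < ord x" using nr(1) st prime_gt_1_nat[OF p] by simp
    \<comment> \<open>Since \<open>v\<close> is a power of \<open>y\<close>, commutation of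
      \<open>x \<otimes> v\<close> with \<open>y\<close> carries over to \<open>x\<close>.\<close>
    finally have "x \<otimes> v \<otimes> y = y \<otimes> (x \<otimes> v)"
      using less.hyps[OF _ xvB _ y] xv xvB by (auto simp: p_element_def)
    moreover have "inv v \<otimes> y = y \<otimes> inv v"
      unfolding v_def using c by (intro commutes_inv commutes_int_pow) auto
    ultimately have "x \<otimes> v \<otimes> inv v \<otimes> y = y \<otimes> (x \<otimes> v \<otimes> inv v)"
      using c v by (intro commutes_mult[where x = "x \<otimes> v" and y = "inv v"]) auto
    then show False using noncomm c v by (simp add: m_assoc)
  qed
qed

section \<open>From elements of large order to the action on all p-elements\<close>

lemma unbounded_scalar:
  assumes p: "Factorial_Ring.prime p" and unb: "unbounded_primary p" and g: "p_element p g"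
  obtains v k e m where "v \<in> B" "p_element p v" "g \<otimes> v \<otimes> inv g = v [^] (k::int)"
    "ord v = p ^ m" "p ^ Suc e * n < ord v" "int p ^ m dvd k ^ (p ^ Suc e) - 1" "[k = 1] (mod int p)"
proof -
  have gc: "g \<in> carrier G" using g by (rule p_element_carrier)
  obtain e where e: "g [^] (p ^ e) = \<one>" using g by (auto simp: p_element_def)
  \<comment> \<open>Not \<open>e\<close> but \<open>Suc e\<close>, so that for \<open>p = 2\<close>
    the exponent is even also if \<open>g\<close> is trivial; later \<open>k\<close> is then
    exchanged for \<open>- k\<close>.\<close>
  have e': "g [^] (p ^ Suc e) = \<one>"
    using nat_pow_pow[OF gc, of "p ^ e" p] e by (simp add: mult.commute)
  \<comment> \<open>The \<open>+ 1\<close> excludes a trivial \<open>v\<close> when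
    \<open>n = 0\<close>, whose order would say nothing about \<open>k\<close> modulo
    \<open>p\<close>.\<close>
  obtain v where v: "v \<in> B" "p_element p v" "p ^ Suc e * n + 1 < ord v"
    using unb unfolding unbounded_primary_def by blast
  obtain m where m: "ord v = p ^ m" using p_element_ord[OF p v(2)] by blast
  have "m \<noteq> 0" using v(3) m by (cases m) auto
  obtain k where k: "g \<otimes> v \<otimes> inv g = v [^] (k::int)" using baer_radical_conj[OF v(1) gc] by blast
  have dvd: "int p ^ m dvd k ^ (p ^ Suc e) - 1"
    using conj_exponent_power[OF gc _ k e'] v(1) by (simp add: m)
  then have "int p dvd k ^ (p ^ Suc e) - 1"
    using \<open>m \<noteq> 0\<close> by (meson dvd_power dvd_trans neq0_conv)
  then have "[k ^ (p ^ Suc e) = 1] (mod int p)" by (simp add: cong_iff_dvd_diff)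
  then have "[k = 1] (mod int p)" using fermat_theorem_int_power[OF p] by (metis cong_sym cong_trans)
  then show ?thesis using that[of v k m e] v k m dvd by simp
qed

lemma ord_pow_gt:
  assumes p: "Factorial_Ring.prime p" and v: "v \<in> B" "p_element p v" "N * n < ord v" and N: "N > 0"
  shows "n < ord (v [^] N)" "v [^] N \<in> B" "p_element p (v [^] N)"
proof -
  show w: "v [^] N \<in> B" "p_element p (v [^] N)"
    using v baer_radical_nat_pow p_element_int_pow[of p v "int N"] by (auto simp: int_pow_int)
  have "ord v \<le> N * ord (v [^] N)"
    using ord_le_mult_ord_pow[OF _ _ N] p_element_ord_gt_0[OF p w(2)] v(1) by simp
  then have "N * n < N * ord (v [^] N)" using v(3) by linarith
  then show "n < ord (v [^] N)" by simp
qed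

text \<open>Passing to \<open>N\<close>-th powers absorbs an error in the exponent that becomes a
  multiple of \<open>ord v\<close> after multiplication by \<open>N\<close>. The values of
  \<open>l\<close> in use are 1 and -1.\<close>

lemma scalar_power:
  assumes "g \<in> carrier G" "v \<in> carrier G" "g \<otimes> v \<otimes> inv g = v [^] (k::int)"
    and "int (ord v) dvd int N * (k - l)"
  shows "g \<otimes> v [^] N \<otimes> inv g = (v [^] N) [^] l"
proof -
  have "g \<otimes> v [^] N \<otimes> inv g = v [^] (k * int N)"
    using conj_nat_pow[OF assms(1,2), of N] assms by (simp add: int_pow_pow flip: int_pow_int)
  also have "\<dots> = v [^] (int N * l)"
    using assms(2,4) by (subst eq_commute) (simp add: int_pow_eq algebra_simps)
  finally show ?thesis using assms(2) by (simp add: int_pow_pow flip: int_pow_int)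
qed

lemma centralizes_primary:
  assumes p: "Factorial_Ring.prime p" and unb: "unbounded_primary p" and g: "p_element p g"
    and large: "\<And>n. \<exists>w\<in>B. p_element p w \<and> n < ord w \<and> g \<otimes> w \<otimes> inv g = w"
    and x: "x \<in> B" "p_element p x"
  shows "g \<otimes> x = x \<otimes> g"
proof -
  have gc: "g \<in> carrier G" using g by (rule p_element_carrier)
  have "commutator x g = \<one>"
  proof (rule primary_power_map_trivial[OF p _ _ _ x])
    fix x assume x: "x \<in> B" "p_element p x"
    obtain w where w: "w \<in> B" "p_element p w" "ord x < ord w" "g \<otimes> w \<otimes> inv g = w"
      using large by blast
    then have "g \<otimes> w = w \<otimes> g" using gc by (simp add: conj_eq_iff_commutes)
    then have "commutator w g = \<one>" using w gc by (simp add: commutator_eq_one_iff)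
    then show "\<exists>w\<in>B. p_element p w \<and> x \<otimes> w = w \<otimes> x \<and> commutator w g = \<one> \<and> ord x \<le> ord w"
      using w x primary_commutes_of_unbounded[OF p unb] by (meson less_imp_le)
  qed (blast intro: gc baer_radical_commutator_pow commutator_mult_left)+
  then have "x \<otimes> g = g \<otimes> x" using x gc by (simp add: commutator_eq_one_iff)
  then show ?thesis by simp
qed

text \<open>The map taking \<open>x\<close> to
  \<open>g \<otimes> x \<otimes> inv g \<otimes> x\<close> is trivial exactly on inverted elements.
  On commuting pairs it is multiplicative, because \<open>g \<otimes> y \<otimes> inv g\<close> is a
  power of \<open>y\<close> and so commutes with \<open>x\<close>.\<close>

lemma inverts_primary:
  assumes p: "Factorial_Ring.prime p" and unb: "unbounded_primary p" and g: "p_element p g"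
    and large: "\<And>n. \<exists>w\<in>B. p_element p w \<and> n < ord w \<and> g \<otimes> w \<otimes> inv g = inv w"
    and x: "x \<in> B" "p_element p x"
  shows "g \<otimes> x \<otimes> inv g = inv x"
proof -
  have gc: "g \<in> carrier G" using g by (rule p_element_carrier)
  have "g \<otimes> x \<otimes> inv g \<otimes> x = \<one>"
  proof (rule primary_power_map_trivial[OF p _ _ _ x])
    fix x assume x: "x \<in> B" "p_element p x"
    obtain k where "g \<otimes> x \<otimes> inv g = x [^] (k::int)" using baer_radical_conj x(1) gc by blast
    then have "g \<otimes> x \<otimes> inv g \<otimes> x = x [^] (k + 1)" using x by (simp add: int_pow_mult)
    then show "\<exists>k::int. g \<otimes> x \<otimes> inv g \<otimes> x = x [^] k" ..
    obtain w where w: "w \<in> B" "p_element p w" "ord x < ord w" "g \<otimes> w \<otimes> inv g = inv w"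
      using large by blast
    then have "g \<otimes> w \<otimes> inv g \<otimes> w = \<one>" by simp
    then show "\<exists>w\<in>B. p_element p w \<and> x \<otimes> w = w \<otimes> x \<and> g \<otimes> w \<otimes> inv g \<otimes> w = \<one> \<and> ord x \<le> ord w"
      using w x primary_commutes_of_unbounded[OF p unb] by (meson less_imp_le)
  next
    fix x y assume x: "x \<in> B" "p_element p x" and y: "y \<in> B" "p_element p y"
      and xy: "x \<otimes> y = y \<otimes> x"
    have c: "x \<in> carrier G" "y \<in> carrier G" using x y by auto
    obtain k where k: "g \<otimes> y \<otimes> inv g = y [^] (k::int)" using baer_radical_conj y(1) gc by blast
    have "x \<otimes> (g \<otimes> y \<otimes> inv g) = (g \<otimes> y \<otimes> inv g) \<otimes> x"
      unfolding k using commutes_int_pow[OF xy[symmetric] c(2,1)] by simp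
    then have "(g \<otimes> x \<otimes> inv g) \<otimes> (x \<otimes> (g \<otimes> y \<otimes> inv g)) \<otimes> y
        = (g \<otimes> x \<otimes> inv g) \<otimes> ((g \<otimes> y \<otimes> inv g) \<otimes> x) \<otimes> y" by simp
    then show "g \<otimes> (x \<otimes> y) \<otimes> inv g \<otimes> (x \<otimes> y) = g \<otimes> x \<otimes> inv g \<otimes> x \<otimes> (g \<otimes> y \<otimes> inv g \<otimes> y)"
      using c gc by (simp add: word_simps)
  qed
  then show ?thesis using x gc by (metis baer_radical_carrier inv_closed inv_equality m_closed)
qed

text \<open>Otherwise there are \<open>v\<close> of unbounded order, and lifting the exponent shows
  that \<open>g\<close> fixes \<open>v [^] (p ^ Suc e)\<close>. These fixed elements have unbounded
  order too, so \<open>g\<close> centralizes all \<open>p\<close>-elements of \<open>B\<close> and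
  lies in \<open>B\<close>.\<close>

lemma p_element_in_baer_radical_of_odd:
  assumes p: "Factorial_Ring.prime p" and odd: "odd p" and g: "p_element p g"
  shows "g \<in> B"
proof (rule ccontr)
  assume "g \<notin> B"
  then have unb: "unbounded_primary p" using unbounded_primaryI p g by blast
  have gc: "g \<in> carrier G" using g by (rule p_element_carrier)
  have large: "\<exists>w\<in>B. p_element p w \<and> n < ord w \<and> g \<otimes> w \<otimes> inv g = w" for n
  proof -
    obtain v k e m where v: "v \<in> B" "p_element p v" "g \<otimes> v \<otimes> inv g = v [^] (k::int)"
      "ord v = p ^ m" "p ^ Suc e * n < ord v" "int p ^ m dvd k ^ (p ^ Suc e) - 1" "[k = 1] (mod int p)"
      by (rule unbounded_scalar[OF p unb g])
    have "p \<noteq> 2" using odd by auto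
    then have "int p ^ m dvd int p ^ Suc e * (k - 1)"
      using prime_power_dvd_power_diff[OF p v(7) _ v(6)] by blast
    then have "g \<otimes> v [^] (p ^ Suc e) \<otimes> inv g = (v [^] (p ^ Suc e)) [^] (1::int)"
      using gc v by (intro scalar_power) (auto simp: v(4))
    then show ?thesis
      using ord_pow_gt[OF p v(1,2,5)] prime_gt_0_nat[OF p] v(1) by (intro bexI[of _ "v [^] (p ^ Suc e)"]) auto
  qed
  show False using p_element_in_baer_radical[OF p g] centralizes_primary[OF p unb g large] \<open>g \<notin> B\<close> by blast
qed

text \<open>The exponent \<open>k\<close> is odd, so \<open>k\<close> or \<open>- k\<close> is 1
  modulo 4, as lifting the exponent requires. The sign may depend on the element, but one of the two
  occurs at arbitrarily large orders and then holds for all 2-elements of \<open>B\<close>.\<close>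

lemma two_element_centralizes_or_inverts:
  assumes unb: "unbounded_primary 2" and g: "p_element 2 g"
  shows "(\<forall>x\<in>B. p_element 2 x \<longrightarrow> g \<otimes> x = x \<otimes> g) \<or>
    (\<forall>x\<in>B. p_element 2 x \<longrightarrow> g \<otimes> x \<otimes> inv g = inv x)"
proof -
  have gc: "g \<in> carrier G" using g by (rule p_element_carrier)
  have p: "Factorial_Ring.prime (2::nat)" by (rule two_is_prime_nat)
  have large: "\<exists>w\<in>B. p_element 2 w \<and> n < ord w \<and> (g \<otimes> w \<otimes> inv g = w \<or> g \<otimes> w \<otimes> inv g = inv w)" for n
  proof -
    obtain v k e m where v: "v \<in> B" "p_element 2 v" "g \<otimes> v \<otimes> inv g = v [^] (k::int)"
      "ord v = 2 ^ m" "2 ^ Suc e * n < ord v" "int 2 ^ m dvd k ^ (2 ^ Suc e) - 1" "[k = 1] (mod int 2)"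
      by (rule unbounded_scalar[OF p unb g])
    let ?w = "v [^] ((2::nat) ^ Suc e)"
    have "odd k" using v(7) by (auto simp: cong_iff_dvd_diff)
    then have "k mod 4 = 1 \<or> k mod 4 = 3" by presburger
    then have "g \<otimes> ?w \<otimes> inv g = ?w [^] (1::int) \<or> g \<otimes> ?w \<otimes> inv g = ?w [^] (-1::int)"
    proof
      assume "k mod 4 = 1"
      then have "int 2 ^ m dvd int 2 ^ Suc e * (k - 1)"
        using v(6,7) by (intro prime_power_dvd_power_diff[OF p]) (auto simp: cong_def)
      then have "g \<otimes> ?w \<otimes> inv g = ?w [^] (1::int)"
        using gc v by (intro scalar_power) (auto simp: v(4))
      then show ?thesis ..
    next
      assume "k mod 4 = 3"
      then have "(- k) mod 4 = 1" by presburger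
      moreover have "(- k) ^ (2 ^ Suc e) = k ^ (2 ^ Suc e)" by simp
      moreover have "[- k = 1] (mod int 2)" using \<open>odd k\<close> by (simp add: cong_iff_dvd_diff)
      ultimately have "int 2 ^ m dvd int 2 ^ Suc e * (- k - 1)"
        using v(6) by (intro prime_power_dvd_power_diff[OF p]) (auto simp: cong_def)
      then have "int 2 ^ m dvd int 2 ^ Suc e * (k - (- 1))"
        by (metis dvd_minus_iff minus_diff_commute minus_mult_right diff_minus_eq_add add.commute minus_diff_eq)
      then have "g \<otimes> ?w \<otimes> inv g = ?w [^] (-1::int)"
        using gc v by (intro scalar_power) (auto simp: v(4))
      then show ?thesis ..
    qed
    then show ?thesis
      using ord_pow_gt[OF p v(1,2,5)] v(1) by (intro bexI[of _ ?w]) (auto simp: int_pow_neg)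
  qed
  show ?thesis
  proof (cases "\<forall>n. \<exists>w\<in>B. p_element 2 w \<and> n < ord w \<and> g \<otimes> w \<otimes> inv g = w")
    case True
    then show ?thesis using centralizes_primary[OF p unb g] by blast
  next
    case False
    then obtain n0 where n0: "\<And>w. w \<in> B \<Longrightarrow> p_element 2 w \<Longrightarrow> n0 < ord w \<Longrightarrow> g \<otimes> w \<otimes> inv g \<noteq> w"
      by blast
    have "\<exists>w\<in>B. p_element 2 w \<and> n < ord w \<and> g \<otimes> w \<otimes> inv g = inv w" for n
      using large[of "max n n0"] n0 by fastforce
    then show ?thesis using inverts_primary[OF p unb g] by blast
  qed
qed

end

section \<open>Sylow subgroups\<close>

context group
begin

lemma coset_image_central:
  assumes N: "N \<lhd> G" and L: "L \<subseteq> carrier G"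
    and comm: "\<And>u g. u \<in> L \<Longrightarrow> g \<in> carrier G \<Longrightarrow> commutator u g \<in> N"
  shows "(\<lambda>x. N #> x) ` L \<subseteq> group_center (G Mod N)"
proof
  interpret N: normal N G by fact
  fix Q assume "Q \<in> (\<lambda>x. N #> x) ` L"
  then obtain u where u: "u \<in> L" "Q = N #> u" by blast
  have uc: "u \<in> carrier G" using u L by blast
  have "N #> (u \<otimes> g) = N #> (g \<otimes> u)" if g: "g \<in> carrier G" for g
  proof -
    have "N #> commutator u g = N"
      using coset_join2[OF _ N.subgroup_axioms comm[OF u(1) g]] uc g by simp
    then have "N #> (g \<otimes> u) = N #> (commutator u g \<otimes> (g \<otimes> u))"
      using uc g N.subset by (metis coset_mult_assoc commutator_closed m_closed)
    then show ?thesis using uc g by (simp add: commutator_def word_simps)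
  qed
  then show "Q \<in> group_center (G Mod N)"
    using u uc by (auto simp: group_center_def carrier_FactGroup N.rcos_sum)
qed

lemma nilpotent_of_class_two:
  assumes "\<And>u v z. u \<in> carrier G \<Longrightarrow> v \<in> carrier G \<Longrightarrow> z \<in> carrier G \<Longrightarrow>
      commutator u v \<otimes> z = z \<otimes> commutator u v"
  shows "nilpotent_group G"
proof -
  have sub: "subgroup (group_center G) G"
  proof (rule subgroupI)
    have "\<one> \<in> group_center G" by (simp add: group_center_def)
    then show "group_center G \<noteq> {}" by blast
    fix x assume x: "x \<in> group_center G"
    show "inv x \<in> group_center G"
      unfolding group_center_def using x by (auto intro: commutes_inv simp: group_center_def)
    fix y assume y: "y \<in> group_center G"
    show "x \<otimes> y \<in> group_center G"
      unfolding group_center_def mem_Collect_eq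
    proof (intro conjI ballI)
      show "x \<otimes> y \<in> carrier G" using x y unfolding group_center_def by blast
      fix g assume "g \<in> carrier G"
      then show "x \<otimes> y \<otimes> g = g \<otimes> (x \<otimes> y)"
        using x y unfolding group_center_def by (blast intro: commutes_mult)
    qed
  next
    show "group_center G \<subseteq> carrier G" unfolding group_center_def by blast
  qed
  have nC: "group_center G \<lhd> G"
  proof (rule normal_invI[OF sub])
    fix x h assume x: "x \<in> carrier G" and h: "h \<in> group_center G"
    then have "x \<otimes> h \<otimes> inv x = h"
      using conj_eq_iff_commutes[of x h] by (simp add: group_center_def)
    then show "x \<otimes> h \<otimes> inv x \<in> group_center G" using h by simp
  qed
  define K where "K i = (if i = 0 then {\<one>} else if i = 1 then group_center G else carrier G)" for i :: nat
  have "(\<lambda>x. {\<one>} #> x) ` group_center G \<subseteq> group_center (G Mod {\<one>})"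
    by (rule coset_image_central[OF one_is_normal]) (auto simp: group_center_def commutator_eq_one_iff)
  moreover have "(\<lambda>x. group_center G #> x) ` carrier G \<subseteq> group_center (G Mod group_center G)"
    by (rule coset_image_central[OF nC]) (use assms in \<open>auto simp: group_center_def\<close>)
  moreover have "{\<one>} \<subseteq> group_center G" "group_center G \<subseteq> carrier G"
    using subgroup.one_closed[OF sub] subgroup.subset[OF sub] by auto
  ultimately have "K 0 = {\<one>} \<and> K 2 = carrier G \<and> (\<forall>i\<le>2. K i \<lhd> G) \<and>
      (\<forall>i<2. K i \<subseteq> K (Suc i) \<and> (\<lambda>x. K i #> x) ` K (Suc i) \<subseteq> group_center (G Mod K i))"
    using nC one_is_normal normal_self by (auto simp: K_def less_Suc_eq numeral_2_eq_2)
  then show ?thesis unfolding nilpotent_group_def by (intro exI[of _ 2] exI[of _ K])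
qed

lemma subgroup_comm_group:
  assumes "subgroup H G" "\<And>x y. x \<in> H \<Longrightarrow> y \<in> H \<Longrightarrow> x \<otimes> y = y \<otimes> x"
  shows "comm_group (G\<lparr>carrier := H\<rparr>)"
proof -
  interpret H: group "G\<lparr>carrier := H\<rparr>"
    using assms(1) by (rule subgroup.subgroup_is_group) (rule is_group)
  show ?thesis by (rule H.group_comm_groupI) (use assms(2) in simp)
qed

lemma subgroup_ord:
  assumes "subgroup H G" "x \<in> H"
  shows "group.ord (G\<lparr>carrier := H\<rparr>) x = ord x"
proof -
  interpret H: group "G\<lparr>carrier := H\<rparr>"
    using assms(1) by (rule subgroup.subgroup_is_group) (rule is_group)
  have "x \<in> carrier G" using assms by (rule subgroup.mem_carrier)
  then have "x [^]\<^bsub>G\<lparr>carrier := H\<rparr>\<^esub> n = \<one> \<longleftrightarrow> ord x dvd n" for n :: nat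
    unfolding nat_pow_consistent[symmetric] by (rule pow_eq_id)
  then show ?thesis using assms(2) by (subst H.ord_unique) simp_all
qed

lemma p_subgroup_element:
  assumes "p_subgroup p P G" "x \<in> P"
  shows "p_element p x"
proof -
  have "x \<in> carrier G" "\<exists>n. ord x = p ^ n"
    using assms subgroup.mem_carrier by (auto simp: p_subgroup_def)
  then show ?thesis unfolding p_element_def by (metis pow_ord_eq_1)
qed

lemma p_subgroupI:
  assumes "Factorial_Ring.prime p" "subgroup P G" "\<And>x. x \<in> P \<Longrightarrow> p_element p x"
  shows "p_subgroup p P G"
  unfolding p_subgroup_def using assms p_element_iff_ord p_element_carrier by blast

text \<open>Modulo \<open>Q\<close> the powers of \<open>d \<otimes> q\<close> are those of
  \<open>d\<close>, so one with exponent a power of \<open>p\<close> lies in \<open>Q\<close>. By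
  maximality a Sylow subgroup then contains every normal \<open>p\<close>-subgroup.\<close>

lemma p_subgroup_mult_normal:
  assumes p: "Factorial_Ring.prime p" and D: "p_subgroup p D G"
    and Q: "Q \<lhd> G" "\<And>x. x \<in> Q \<Longrightarrow> p_element p x"
  shows "p_subgroup p (D <#> Q) G"
proof (rule p_subgroupI[OF p])
  interpret Q: normal Q G by fact
  have sD: "subgroup D G" using D by (simp add: p_subgroup_def)
  show "subgroup (D <#> Q) G"
    using mult_norm_subgroup[OF Q(1) sD] commut_normal[OF sD Q(1)] by simp
  fix x assume "x \<in> D <#> Q"
  then obtain d q where dq: "d \<in> D" "q \<in> Q" "x = d \<otimes> q" by (auto simp: set_mult_def)
  have c: "d \<in> carrier G" "q \<in> carrier G" using dq Q.mem_carrier subgroup.mem_carrier[OF sD] by auto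
  have pow: "\<exists>q'\<in>Q. x [^] n = d [^] n \<otimes> q'" for n :: nat
  proof (induction n)
    case 0
    then show ?case using Q.one_closed by (auto intro!: bexI[of _ \<one>])
  next
    case (Suc n)
    then obtain q' where q': "q' \<in> Q" "x [^] n = d [^] n \<otimes> q'" by blast
    have "x [^] Suc n = d [^] Suc n \<otimes> (inv d \<otimes> q' \<otimes> d \<otimes> q)"
      using q' c dq(3) Q.mem_carrier[OF q'(1)] by (simp add: word_simps)
    moreover have "inv d \<otimes> q' \<otimes> d \<otimes> q \<in> Q" using Q.inv_op_closed1 c q' dq by auto
    ultimately show ?case by blast
  qed
  obtain m where m: "d [^] (p ^ m) = \<one>" using p_subgroup_element[OF D dq(1)] by (auto simp: p_element_def)
  obtain q' where q': "q' \<in> Q" "x [^] (p ^ m) = d [^] (p ^ m) \<otimes> q'" using pow by blast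
  then have "x [^] (p ^ m) = q'" using m Q.mem_carrier by simp
  moreover obtain j where "q' [^] (p ^ j) = \<one>" using Q(2)[OF q'(1)] by (auto simp: p_element_def)
  ultimately have "x [^] (p ^ (m + j)) = \<one>"
    using c dq(3) nat_pow_pow[of x "p ^ m" "p ^ j"] by (simp add: power_add)
  then show "p_element p x" unfolding p_element_def using c dq(3) by blast
qed

end

section \<open>The Sylow subgroups of the given group\<close>

context periodic_baer_radical
begin

lemma odd_p_subgroup_abelian:
  assumes p: "Factorial_Ring.prime p" "odd p" and P: "p_subgroup p P G"
  shows "comm_group (G\<lparr>carrier := P\<rparr>)"
proof (rule subgroup_comm_group)
  show "subgroup P G" using P by (simp add: p_subgroup_def)
  fix x y assume "x \<in> P" "y \<in> P"
  then show "x \<otimes> y = y \<otimes> x"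
    using p_subgroup_element[OF P] p_element_in_baer_radical_of_odd[OF p] primary_commutes_of_odd[OF p]
    by blast
qed

lemma nilpotent_of_subset_baer_radical:
  assumes D: "subgroup D G" "D \<subseteq> B"
  shows "nilpotent_group (G\<lparr>carrier := D\<rparr>)"
proof -
  interpret D: group "G\<lparr>carrier := D\<rparr>"
    using D(1) by (rule subgroup.subgroup_is_group) (rule is_group)
  show ?thesis
  proof (rule D.nilpotent_of_class_two)
    fix u v z assume "u \<in> carrier (G\<lparr>carrier := D\<rparr>)" "v \<in> carrier (G\<lparr>carrier := D\<rparr>)"
      "z \<in> carrier (G\<lparr>carrier := D\<rparr>)"
    then have uvz: "u \<in> D" "v \<in> D" "z \<in> D" by auto
    then have "D.commutator u v = commutator u v"
      using D(1) unfolding D.commutator_def commutator_def by simp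
    moreover have "commutator u v \<otimes> z = z \<otimes> commutator u v"
      using uvz D(2) by (intro commutator_centralizes_baer_radical) auto
    ultimately show "D.commutator u v \<otimes>\<^bsub>G\<lparr>carrier := D\<rparr>\<^esub> z = z \<otimes>\<^bsub>G\<lparr>carrier := D\<rparr>\<^esub> D.commutator u v"
      by simp
  qed
qed

text \<open>An element of \<open>D\<close> outside \<open>B\<close> yields unboundedness, hence the
  dichotomy for all of \<open>D\<close>. Elements of \<open>D\<close> that centralize
  \<open>Q\<close> lie in \<open>Q\<close>, so those outside \<open>Q\<close> invert it; two of
  these multiply to a centralizing element, and \<open>Q\<close> has index two in
  \<open>D\<close>.\<close>

lemma sylow_two_structure:
  assumes D: "sylow_subgroup 2 D G" and non_nilpotent: "\<not> nilpotent_group (G\<lparr>carrier := D\<rparr>)"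
    and B2: "sylow_subgroup 2 B\<^sub>2 (G\<lparr>carrier := B\<rparr>)"
  shows "comm_group (G\<lparr>carrier := B\<^sub>2\<rparr>)" "\<exists>x\<in>B\<^sub>2. n < ord x"
    and "\<exists>a\<in>carrier G. (D = B\<^sub>2 <#> generate G {a} \<and> a [^] (2::nat) \<in> B\<^sub>2 \<and>
        (\<forall>x\<in>B\<^sub>2. conjugate G x a = inv x)) \<and>
      (subgroup (centralizer_in G B\<^sub>2 a) G \<and>
        elementary_abelian 2 (G\<lparr>carrier := centralizer_in G B\<^sub>2 a\<rparr>)) \<and>
      (a [^] (2::nat) = \<one> \<or> a [^] (4::nat) = \<one>)"
proof -
  have p: "Factorial_Ring.prime (2::nat)" by (rule two_is_prime_nat)
  have pD: "p_subgroup 2 D G" and maxD: "\<And>Q. p_subgroup 2 Q G \<Longrightarrow> D \<subseteq> Q \<Longrightarrow> Q = D"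
    using D by (auto simp: sylow_subgroup_def)
  have sD: "subgroup D G" using pD by (simp add: p_subgroup_def)
  have De: "p_element 2 x" if "x \<in> D" for x using p_subgroup_element pD that by blast
  obtain a where a: "a \<in> D" "a \<notin> B"
    using nilpotent_of_subset_baer_radical[OF sD] non_nilpotent by blast
  have ac: "a \<in> carrier G" using sD a(1) by (rule subgroup.mem_carrier)
  have unb: "unbounded_primary 2" using unbounded_primaryI[OF p De] a by blast
  define Q where "Q = {x \<in> B. p_element 2 x}"
  have Q_comm: "x \<otimes> y = y \<otimes> x" if "x \<in> Q" "y \<in> Q" for x y
    using that primary_commutes_of_unbounded[OF p unb] by (auto simp: Q_def)
  have Qc: "x \<in> carrier G" if "x \<in> Q" for x using that by (simp add: Q_def)
  have Q_pow: "x [^] (k::int) \<in> Q" if "x \<in> Q" for x k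
    using that by (simp add: Q_def baer_radical_int_pow p_element_int_pow)
  have sQ: "subgroup Q G"
  proof (rule subgroupI)
    show "Q \<noteq> {}" using unb by (auto simp: Q_def unbounded_primary_def)
    show "inv x \<in> Q" if "x \<in> Q" for x
      using Q_pow[OF that, of "-1"] Qc[OF that] by (simp add: int_pow_neg)
    show "x \<otimes> y \<in> Q" if "x \<in> Q" "y \<in> Q" for x y
      using that Q_comm[OF that] by (auto simp: Q_def baer_radical_mult p_element_mult)
  qed (auto simp: Qc)
  have nQ: "Q \<lhd> G"
  proof (rule normal_invI[OF sQ])
    fix g x assume g: "g \<in> carrier G" and x: "x \<in> Q"
    then obtain k where "g \<otimes> x \<otimes> inv g = x [^] (k::int)"
      using baer_radical_conj[of x g] unfolding Q_def by blast
    then show "g \<otimes> x \<otimes> inv g \<in> Q" using Q_pow[OF x] by simp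
  qed
  have B2Q: "B\<^sub>2 = Q"
  proof -
    let ?B = "G\<lparr>carrier := B\<rparr>"
    interpret B: group ?B
      using baer_radical_subgroup by (rule subgroup.subgroup_is_group) (rule is_group)
    have sub: "subgroup B\<^sub>2 ?B" using B2 by (simp add: sylow_subgroup_def p_subgroup_def)
    have "B\<^sub>2 \<subseteq> Q"
    proof
      fix x assume x: "x \<in> B\<^sub>2"
      have xB: "x \<in> B" using subgroup.subset[OF sub] x by auto
      obtain n where "B.ord x = 2 ^ n" using B2 x by (auto simp: sylow_subgroup_def p_subgroup_def)
      then have "ord x = 2 ^ n" using subgroup_ord[OF baer_radical_subgroup xB] by simp
      then show "x \<in> Q" using xB p_element_iff_ord[OF p, of x] by (auto simp: Q_def)
    qed
    moreover have "p_subgroup 2 Q ?B"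
      unfolding p_subgroup_def
    proof
      show "subgroup Q ?B" using sQ baer_radical_subgroup by (rule subgroup_incl) (auto simp: Q_def)
      show "\<forall>x\<in>Q. \<exists>n. B.ord x = 2 ^ n"
        using subgroup_ord[OF baer_radical_subgroup] p_element_ord[OF p] by (metis (no_types, lifting) Q_def mem_Collect_eq)
    qed
    ultimately show ?thesis using B2 by (auto simp: sylow_subgroup_def)
  qed
  show "comm_group (G\<lparr>carrier := B\<^sub>2\<rparr>)" unfolding B2Q using sQ Q_comm by (rule subgroup_comm_group)
  show "\<exists>x\<in>B\<^sub>2. n < ord x" using unb unfolding B2Q unbounded_primary_def Q_def by blast
  have QD: "Q \<subseteq> D"
  proof -
    have "p_subgroup 2 (D <#> Q) G" using p_subgroup_mult_normal[OF p pD nQ] by (simp add: Q_def)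
    moreover have "D \<subseteq> D <#> Q"
      using subgroup.one_closed[OF sQ] subgroup.mem_carrier[OF sD] by (force simp: set_mult_def)
    ultimately have "D <#> Q = D" by (rule maxD)
    moreover have "Q \<subseteq> D <#> Q"
      using subgroup.one_closed[OF sD] Qc by (force simp: set_mult_def)
    ultimately show ?thesis by simp
  qed
  have centralizing: "g \<in> Q" if "g \<in> D" "\<And>x. x \<in> Q \<Longrightarrow> g \<otimes> x = x \<otimes> g" for g
    using p_element_in_baer_radical[OF p De[OF that(1)]] that De by (auto simp: Q_def)
  have inverting: "g \<otimes> x \<otimes> inv g = inv x" if "g \<in> D" "g \<notin> Q" "x \<in> Q" for g x
    using two_element_centralizes_or_inverts[OF unb De[OF that(1)]] centralizing[OF that(1)] that
    by (auto simp: Q_def)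
  have "a \<notin> Q" using a by (simp add: Q_def)
  note a_inv = inverting[OF a(1) this]
  have invQ: "inv x \<in> Q" if "x \<in> Q" for x using sQ that by (rule subgroup.m_inv_closed)
  have prod: "g \<otimes> h \<in> Q" if g: "g \<in> D" "\<And>x. x \<in> Q \<Longrightarrow> g \<otimes> x \<otimes> inv g = inv x"
    and h: "h \<in> D" "\<And>x. x \<in> Q \<Longrightarrow> h \<otimes> x \<otimes> inv h = inv x" for g h
  proof (rule centralizing)
    have c: "g \<in> carrier G" "h \<in> carrier G" using g h subgroup.mem_carrier[OF sD] by auto
    show "g \<otimes> h \<in> D" using sD g(1) h(1) by (rule subgroup.m_closed)
    fix x assume x: "x \<in> Q"
    have "g \<otimes> h \<otimes> x \<otimes> inv (g \<otimes> h) = g \<otimes> (h \<otimes> x \<otimes> inv h) \<otimes> inv g"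
      using c Qc[OF x] by (simp add: word_simps)
    also have "\<dots> = x" using g(2)[OF invQ[OF x]] h(2)[OF x] Qc[OF x] by simp
    finally show "g \<otimes> h \<otimes> x = x \<otimes> (g \<otimes> h)" using c Qc[OF x] conj_eq_iff_commutes by blast
  qed
  \<comment> \<open>Passes from the left action to the conjugation \<open>x^a\<close> of the
    theorem, and shows that \<open>inv a\<close> inverts \<open>Q\<close> too.\<close>
  have a_inv': "inv a \<otimes> x \<otimes> a = inv x" if x: "x \<in> Q" for x
  proof -
    have "inv a \<otimes> x \<otimes> a = inv a \<otimes> (a \<otimes> inv x \<otimes> inv a) \<otimes> a"
      using a_inv[OF invQ[OF x]] Qc[OF x] by simp
    then show ?thesis using ac Qc[OF x] by (simp add: word_simps)
  qed
  have a2: "a [^] (2::nat) \<in> Q"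
    using prod[OF a(1) a_inv a(1) a_inv] ac by (simp add: numeral_2_eq_2)
  have sa: "subgroup (generate G {a}) G" using ac by (simp add: generate_is_subgroup)
  have D_eq: "D = Q <#> generate G {a}"
  proof
    show "Q <#> generate G {a} \<subseteq> D"
    proof
      fix x assume "x \<in> Q <#> generate G {a}"
      then obtain q b where "q \<in> Q" "b \<in> generate G {a}" "x = q \<otimes> b" by (auto simp: set_mult_def)
      moreover have "generate G {a} \<subseteq> D" using generate_subgroup_incl[OF _ sD] a by simp
      ultimately show "x \<in> D" using QD subgroup.m_closed[OF sD] by blast
    qed
    show "D \<subseteq> Q <#> generate G {a}"
    proof
      fix g assume g: "g \<in> D"
      have gc: "g \<in> carrier G" using sD g by (rule subgroup.mem_carrier)
      show "g \<in> Q <#> generate G {a}"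
      proof (cases "g \<in> Q")
        case True
        then have "\<exists>q\<in>Q. \<exists>b\<in>generate G {a}. g = q \<otimes> b"
          using gc generate.one by (metis r_one)
        then show ?thesis by (auto simp: set_mult_def)
      next
        case False
        have "g \<otimes> inv a \<in> Q"
          using prod[OF g inverting[OF g False], of "inv a"] subgroup.m_inv_closed[OF sD a(1)] a_inv' ac
          by simp
        moreover have "a \<in> generate G {a}" by (simp add: generate.incl)
        moreover have "g = g \<otimes> inv a \<otimes> a" using gc ac by (simp add: m_assoc)
        ultimately show ?thesis unfolding set_mult_def by blast
      qed
    qed
  qed
  have C_eq: "centralizer_in G Q a = {x \<in> Q. x \<otimes> a = a \<otimes> x}" by (simp add: centralizer_in_def)
  have sC: "subgroup (centralizer_in G Q a) G" unfolding C_eq using sQ ac by (rule centralizer_subgroup)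
  have C2: "x [^] (2::nat) = \<one>" if x: "x \<in> centralizer_in G Q a" for x
  proof -
    have xQ: "x \<in> Q" "x \<otimes> a = a \<otimes> x" using x by (auto simp: C_eq)
    have "a \<otimes> x \<otimes> inv a = x" using conj_eq_iff_commutes[OF ac Qc[OF xQ(1)]] xQ(2) by simp
    \<comment> \<open>An element commuting with \<open>a\<close> is both fixed and inverted by
      it.\<close>
    then have "x = inv x" using a_inv[OF xQ(1)] by simp
    then have "x \<otimes> x = \<one>" using Qc[OF xQ(1)] r_inv by metis
    then show ?thesis using Qc[OF xQ(1)] by (simp add: numeral_2_eq_2)
  qed
  have "elementary_abelian 2 (G\<lparr>carrier := centralizer_in G Q a\<rparr>)"
    unfolding elementary_abelian_def
  proof
    show "comm_group (G\<lparr>carrier := centralizer_in G Q a\<rparr>)"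
      using sC by (rule subgroup_comm_group) (auto simp: C_eq Q_comm)
  qed (use C2 in \<open>simp flip: nat_pow_consistent\<close>)
  moreover have "a [^] (4::nat) = \<one>"
  proof -
    have "a [^] (2::nat) \<in> centralizer_in G Q a"
      using a2 ac by (simp add: C_eq commutes_nat_pow)
    then have "(a [^] (2::nat)) [^] (2::nat) = \<one>" by (rule C2)
    then show ?thesis using ac by (simp add: nat_pow_pow)
  qed
  ultimately show "\<exists>a\<in>carrier G. (D = B\<^sub>2 <#> generate G {a} \<and> a [^] (2::nat) \<in> B\<^sub>2 \<and>
        (\<forall>x\<in>B\<^sub>2. conjugate G x a = inv x)) \<and>
      (subgroup (centralizer_in G B\<^sub>2 a) G \<and>
        elementary_abelian 2 (G\<lparr>carrier := centralizer_in G B\<^sub>2 a\<rparr>)) \<and>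
      (a [^] (2::nat) = \<one> \<or> a [^] (4::nat) = \<one>)"
    unfolding B2Q conjugate_def using ac D_eq a2 a_inv' sC by blast
qed

end

theorem corollaryA1:
  fixes G :: "('a, 'b) monoid_scheme" (structure)
    and B :: "'a set"
  assumes "group G"
    and "hyperabelian G"
    and "\<And>A. subnormal_subgroup A G \<Longrightarrow> comm_group (subgroup_as_group G A) \<Longrightarrow> A \<lhd> G"
    and "B = baer_radical G"
    and "periodic_group (subgroup_as_group G B)"
    and "locally_nilpotent_group G"
  shows "(\<forall>(p::nat) P. Factorial_Ring.prime p \<and> odd p \<and> sylow_subgroup p P G
            \<longrightarrow> comm_group (subgroup_as_group G P)) \<and>
         (\<forall>D B\<^sub>2. sylow_subgroup 2 D G \<and> \<not> nilpotent_group (subgroup_as_group G D) \<and>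
            sylow_subgroup 2 B\<^sub>2 (subgroup_as_group G B) \<longrightarrow>
            (comm_group (subgroup_as_group G B\<^sub>2) \<and> (\<forall>n::nat. \<exists>x\<in>B\<^sub>2. group.ord G x > n)) \<and>
            (\<exists>a\<in>carrier G.
               (D = B\<^sub>2 <#> generate G {a} \<and> a [^] (2::nat) \<in> B\<^sub>2 \<and>
                (\<forall>x\<in>B\<^sub>2. conjugate G x a = inv x)) \<and>
               (subgroup (centralizer_in G B\<^sub>2 a) G \<and>
                elementary_abelian 2 (subgroup_as_group G (centralizer_in G B\<^sub>2 a))) \<and>
               (a [^] (2::nat) = \<one> \<or> a [^] (4::nat) = \<one>)))"
proof -
  interpret group G by fact
  have "\<exists>n::nat. n > 0 \<and> b [^] n = \<one>" if "b \<in> baer_radical G" for b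
    using assms(4,5) that by (auto simp: periodic_group_def simp flip: nat_pow_consistent)
  then interpret periodic_baer_radical G
    using assms
    by (intro periodic_baer_radical.intro abelian_subnormals_normal.intro
        abelian_subnormals_normal_axioms.intro periodic_baer_radical_axioms.intro) auto
  show ?thesis
  proof (intro conjI[OF _ allI[OF allI[OF impI]]] allI impI)
    fix p :: nat and P
    assume "Factorial_Ring.prime p \<and> odd p \<and> sylow_subgroup p P G"
    then show "comm_group (subgroup_as_group G P)"
      by (intro odd_p_subgroup_abelian[of p]) (auto simp: sylow_subgroup_def)
  next
    fix D B\<^sub>2
    assume "sylow_subgroup 2 D G \<and> \<not> nilpotent_group (subgroup_as_group G D) \<and>
      sylow_subgroup 2 B\<^sub>2 (subgroup_as_group G B)"
    then have D: "sylow_subgroup 2 D G" "\<not> nilpotent_group (subgroup_as_group G D)"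
      "sylow_subgroup 2 B\<^sub>2 (subgroup_as_group G (baer_radical G))"
      using assms(4) by auto
    show "(comm_group (subgroup_as_group G B\<^sub>2) \<and> (\<forall>n::nat. \<exists>x\<in>B\<^sub>2. ord x > n)) \<and>
      (\<exists>a\<in>carrier G.
         (D = B\<^sub>2 <#> generate G {a} \<and> a [^] (2::nat) \<in> B\<^sub>2 \<and>
          (\<forall>x\<in>B\<^sub>2. conjugate G x a = inv x)) \<and>
         (subgroup (centralizer_in G B\<^sub>2 a) G \<and>
          elementary_abelian 2 (subgroup_as_group G (centralizer_in G B\<^sub>2 a))) \<and>
         (a [^] (2::nat) = \<one> \<or> a [^] (4::nat) = \<one>))"
      using sylow_two_structure[OF D] by (intro conjI allI)
  qed
qed

end
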